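(* Let $\lambda>0$, let $A$ be a positive, injective self-adjoint operator on a Hilbert space $\mathbb H$, and let $f\in D(A)$. Let $u$ be the unique solution of the abstract Euler-Poisson-Darboux problem $$\Big[\partial_t^2+\frac{2\lambda}{t}\partial_t+A\Big]u=0,\quad t>0,\qquad u(0)=f,\quad\partial_tu(0)=0,$$ and let $\bar u$ be the unique solution of the abstract wave equation $(\partial_t^2+A)\bar u=0$ with $\bar u(0)=f$, $\partial_t\bar u(0)=0$. Then $u$ is an Erdélyi-Kober fractional integral of $\bar u$: for each $t>0$, $$u(t)=\frac{\Gamma(\lambda+\frac12)}{\sqrt\pi}\,\big(I_\lambda^{1}g_t\big)(1),\qquad g_t(y)=\frac{\bar u(t\sqrt y)}{\sqrt y},\quad y>0.$$
   Context: The Erdélyi-Kober fractional integral is $$(I_\alpha^{m}g)(x)=\frac{m}{\Gamma(\alpha)}\int_0^x(x^m-y^m)^{\alpha-1}y^{m-1}g(y)\,dy,\qquad \alpha>0,\ m>0,$$ understood as a Bochner integral for $\mathbb H$-valued $g$. By the spectral theorem there are a unitary $U:\mathbb H\to L^2(\Omega,\Sigma,\mu)$ and a measurable, a.e. positive $m$ with $UAU^{-1}$ equal to multiplication by $m$; the solution $u$ is $U^{-1}\widehat u$ where, for a.e. $\xi$, $\widehat u(\cdot,\xi)$ solves $\partial_t^2\widehat u+\frac{2\lambda}t\partial_t\widehat u+m(\xi)\widehat u=0$, $\widehat u(0,\xi)=(Uf)(\xi)$, $\partial_t\widehat u(0,\xi)=0$. *)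

theory Defs
  imports "HOL-Analysis.Analysis"
begin

text \<open>
  Hilbert spaces are types of sort \<open>{real_inner, complete_space}\<close>. A complex Hilbert space is covered
  by restriction of scalars, with the real part of its inner product: a complex-linear operator that
  is self-adjoint, positive or injective remains so over the reals (for the adjoint, test with
  \<open>x\<close> and \<open>i x\<close> in the domain, which is a complex subspace).

  An unbounded operator is a pair of a domain \<open>D\<close> and a total function \<open>A\<close> whose values outside
  \<open>D\<close> are irrelevant.
\<close>

definition linear_operator :: "'h::real_vector set \<Rightarrow> ('h \<Rightarrow> 'h) \<Rightarrow> bool" where
  "linear_operator D A \<longleftrightarrow> subspace D \<and>
     (\<forall>x\<in>D. \<forall>y\<in>D. A (x + y) = A x + A y) \<and> (\<forall>c. \<forall>x\<in>D. A (c *\<^sub>R x) = c *\<^sub>R A x)"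

definition adjoint_graph :: "'h::real_inner set \<Rightarrow> ('h \<Rightarrow> 'h) \<Rightarrow> ('h \<times> 'h) set" where
  "adjoint_graph D A = {(y, z). \<forall>x\<in>D. A x \<bullet> y = x \<bullet> z}"

definition selfadjoint :: "'h::real_inner set \<Rightarrow> ('h \<Rightarrow> 'h) \<Rightarrow> bool" where
  "selfadjoint D A \<longleftrightarrow> linear_operator D A \<and> closure D = UNIV \<and>
     adjoint_graph D A = {(y, A y) |y. y \<in> D}"

definition positive_operator :: "'h::real_inner set \<Rightarrow> ('h \<Rightarrow> 'h) \<Rightarrow> bool" where
  "positive_operator D A \<longleftrightarrow> (\<forall>x\<in>D. 0 \<le> A x \<bullet> x)"

text \<open>
  The Bochner integral of the library is confined to second countable target types. The following is
  the same definition for an arbitrary normed space; strong measurability is part of it, through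
  the approximating simple functions.
\<close>

definition has_bochner :: "'a measure \<Rightarrow> ('a \<Rightarrow> 'b::real_normed_vector) \<Rightarrow> 'b \<Rightarrow> bool" where
  "has_bochner M g I \<longleftrightarrow> g \<in> borel_measurable M \<and>
     (\<exists>s. (\<forall>i. Bochner_Integration.simple_bochner_integrable M (s i)) \<and>
          (\<lambda>i. \<integral>\<^sup>+x. ennreal (norm (g x - s i x)) \<partial>M) \<longlonglongrightarrow> 0 \<and>
          (\<lambda>i. Bochner_Integration.simple_bochner_integral M (s i)) \<longlonglongrightarrow> I)"

definition bochner_integrable :: "'a measure \<Rightarrow> ('a \<Rightarrow> 'b::real_normed_vector) \<Rightarrow> bool" where
  "bochner_integrable M g \<longleftrightarrow> (\<exists>I. has_bochner M g I)"

definition bochner_integral :: "'a measure \<Rightarrow> ('a \<Rightarrow> 'b::real_normed_vector) \<Rightarrow> 'b" where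
  "bochner_integral M g = (THE I. has_bochner M g I)"

definition EK_integrand ::
  "real \<Rightarrow> real \<Rightarrow> (real \<Rightarrow> 'h::real_normed_vector) \<Rightarrow> real \<Rightarrow> real \<Rightarrow> 'h" where
  "EK_integrand \<alpha> m g x y = ((x powr m - y powr m) powr (\<alpha> - 1) * y powr (m - 1)) *\<^sub>R g y"

definition EK_integrable ::
  "real \<Rightarrow> real \<Rightarrow> (real \<Rightarrow> 'h::real_normed_vector) \<Rightarrow> real \<Rightarrow> bool" where
  "EK_integrable \<alpha> m g x \<longleftrightarrow> bochner_integrable (lebesgue_on {0<..<x}) (EK_integrand \<alpha> m g x)"

definition EK_integral ::
  "real \<Rightarrow> real \<Rightarrow> (real \<Rightarrow> 'h::real_normed_vector) \<Rightarrow> real \<Rightarrow> 'h" where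
  "EK_integral \<alpha> m g x =
     (m / Gamma \<alpha>) *\<^sub>R bochner_integral (lebesgue_on {0<..<x}) (EK_integrand \<alpha> m g x)"

text \<open>
  Solutions of the initial value problems, with only the regularity needed to write them down.
  The derivative at 0 is one-sided; values \<open>u t\<close> for \<open>t < 0\<close> play no role.
\<close>

definition solves_EPD ::
  "real \<Rightarrow> 'h::real_normed_vector set \<Rightarrow> ('h \<Rightarrow> 'h) \<Rightarrow> 'h \<Rightarrow> (real \<Rightarrow> 'h) \<Rightarrow> bool" where
  "solves_EPD lam D A f u \<longleftrightarrow> (\<exists>u1 u2.
     (\<forall>t\<ge>0. (u has_vector_derivative u1 t) (at t within {0..})) \<and>
     (\<forall>t>0. (u1 has_vector_derivative u2 t) (at t)) \<and>
     (\<forall>t>0. u t \<in> D \<and> u2 t + (2 * lam / t) *\<^sub>R u1 t + A (u t) = 0) \<and>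
     u 0 = f \<and> u1 0 = 0)"

definition solves_wave ::
  "'h::real_normed_vector set \<Rightarrow> ('h \<Rightarrow> 'h) \<Rightarrow> 'h \<Rightarrow> (real \<Rightarrow> 'h) \<Rightarrow> bool" where
  "solves_wave D A f u \<longleftrightarrow> (\<exists>u1 u2.
     (\<forall>t\<ge>0. (u has_vector_derivative u1 t) (at t within {0..})) \<and>
     (\<forall>t>0. (u1 has_vector_derivative u2 t) (at t)) \<and>
     (\<forall>t>0. u t \<in> D \<and> u2 t + A (u t) = 0) \<and>
     u 0 = f \<and> u1 0 = 0)"

text \<open>
  Spectral representation. Elements of \<open>L\<^sup>2\<close> are square-integrable functions modulo equality almost
  everywhere, so \<open>U\<close> chooses a representative of each class and its properties hold almost
  everywhere. The sort of \<open>'k\<close> admits exactly the scalar fields \<open>real\<close> and \<open>complex\<close>, up to isomorphism.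
\<close>

definition L2 :: "'o measure \<Rightarrow> ('o \<Rightarrow> 'k::euclidean_space) set" where
  "L2 M = {g \<in> borel_measurable M. integrable M (\<lambda>\<xi>. (norm (g \<xi>))\<^sup>2)}"

definition unitary_onto_L2 ::
  "'o measure \<Rightarrow> ('h::real_inner \<Rightarrow> 'o \<Rightarrow> 'k::euclidean_space) \<Rightarrow> bool" where
  "unitary_onto_L2 M U \<longleftrightarrow>
     (\<forall>x. U x \<in> L2 M) \<and>
     (\<forall>x y. AE \<xi> in M. U (x + y) \<xi> = U x \<xi> + U y \<xi>) \<and>
     (\<forall>c x. AE \<xi> in M. U (c *\<^sub>R x) \<xi> = c *\<^sub>R U x \<xi>) \<and>
     (\<forall>x. (norm x)\<^sup>2 = (\<integral>\<xi>. (norm (U x \<xi>))\<^sup>2 \<partial>M)) \<and>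
     (\<forall>g\<in>L2 M. \<exists>x. AE \<xi> in M. U x \<xi> = g \<xi>)"

definition spectral_representation ::
  "'h::real_inner set \<Rightarrow> ('h \<Rightarrow> 'h) \<Rightarrow> 'o measure \<Rightarrow> ('o \<Rightarrow> real) \<Rightarrow>
   ('h \<Rightarrow> 'o \<Rightarrow> 'k::{real_normed_field, euclidean_space}) \<Rightarrow> bool" where
  "spectral_representation D A M m U \<longleftrightarrow>
     m \<in> borel_measurable M \<and> (AE \<xi> in M. 0 < m \<xi>) \<and> unitary_onto_L2 M U \<and>
     (\<forall>x. x \<in> D \<longleftrightarrow> (\<lambda>\<xi>. m \<xi> *\<^sub>R U x \<xi>) \<in> L2 M) \<and>
     (\<forall>x\<in>D. AE \<xi> in M. U (A x) \<xi> = m \<xi> *\<^sub>R U x \<xi>)"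

text \<open>Here \<open>v \<xi> t\<close> is \<open>(U (u t)) \<xi>\<close>, chosen so that it solves the scalar problem for almost every \<open>\<xi>\<close>.\<close>

definition spectral_solves_EPD ::
  "real \<Rightarrow> 'o measure \<Rightarrow> ('o \<Rightarrow> real) \<Rightarrow>
   ('h::real_inner \<Rightarrow> 'o \<Rightarrow> 'k::{real_normed_field, euclidean_space}) \<Rightarrow>
   'h \<Rightarrow> (real \<Rightarrow> 'h) \<Rightarrow> bool" where
  "spectral_solves_EPD lam M m U f u \<longleftrightarrow> (\<exists>v.
     (\<forall>t\<ge>0. AE \<xi> in M. U (u t) \<xi> = v \<xi> t) \<and>
     (AE \<xi> in M. solves_EPD lam UNIV (\<lambda>z. m \<xi> *\<^sub>R z) (U f \<xi>) (v \<xi>)))"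

definition spectral_solves_wave ::
  "'o measure \<Rightarrow> ('o \<Rightarrow> real) \<Rightarrow>
   ('h::real_inner \<Rightarrow> 'o \<Rightarrow> 'k::{real_normed_field, euclidean_space}) \<Rightarrow>
   'h \<Rightarrow> (real \<Rightarrow> 'h) \<Rightarrow> bool" where
  "spectral_solves_wave M m U f u \<longleftrightarrow> (\<exists>v.
     (\<forall>t\<ge>0. AE \<xi> in M. U (u t) \<xi> = v \<xi> t) \<and>
     (AE \<xi> in M. solves_wave UNIV (\<lambda>z. m \<xi> *\<^sub>R z) (U f \<xi>) (v \<xi>)))"

end

(*
  No spectral theorem is needed. Let B = (1 + A)^(-1), which is bounded, symmetric, positive and
  injective, and C = 1 - B, so that BA = C on D. A classical solution u has no a priori continuity of
  u'' or of A u, and u' may be discontinuous at 0, but v = B u satisfies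
  v'' + (2 lam/t) v' = -C u with continuous right-hand side, which forces v'(t) = O(t), and
  B v'' + (2 lam/t) B v' + C v = 0 with bounded coefficients. For that equation the energy
  <B v', v'> + <C v, v> is nonincreasing, whence uniqueness. Differentiating under the integral and
  integrating by parts shows that the Erdelyi-Kober integral of B ubar solves the same problem as
  B u; since B is injective, the formula follows.

  The integrals are handled weakly, through their inner products with fixed vectors; they exist by
  the Riesz representation theorem. A solution given through the spectral representation is a
  classical one: the scalar energy estimates bound v, v' and v'' by a multiple of
  (1 + m) |U f|, which is square integrable because f is in D, and dominated convergence applies.
*)
theory Submission
  imports Defs
begin

text \<open>The weight in the formula is the Beta(1/2, lam) density: Gamma(lam + 1/2) / sqrt pi is
  Gamma(lam) / Beta(1/2, lam). With b = Beta(1/2, lam) and Z(t) the unnormalized integral of ubar(t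
  sqrt y), the claim is b u = Z.

  The resolvent is applied twice, for different reasons. Differentiating Z under the integral would
  need ubar' and ubar'' to be continuous up to 0. For B ubar both are, so W = B Z can be
  differentiated. The difference v = B (b u - Z) then satisfies v'' + (2 lam/t) v' = - C (b u - Z),
  whose right side is not a bounded operator applied to v. A second B turns it into - C v, because B
  and C commute; the price is that kinetic energy is measured in the weaker form <B x, x>, which is
  still definite.

  Strong integrability of the integrand is a separate matter. It rests on the product form, an
  integrable kernel times a continuous path, for which simple approximants can be written down;
  their integrals are compared with the value already known weakly.\<close>

section \<open>Riesz representation and the resolvent\<close>

text \<open>\<open>w\<close> is found in the closure of \<open>S\<close>, possibly outside
  \<open>S\<close>: it is the limit of a minimizing sequence of the quadratic functional
  \<open>J\<close>, and the claim is the first-order condition at the minimum.\<close>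

lemma riesz_on_subspace:
  fixes S :: "'h::{real_inner, complete_space} set" and l :: "'h \<Rightarrow> real"
  assumes S: "subspace S"
    and add: "\<And>x y. x \<in> S \<Longrightarrow> y \<in> S \<Longrightarrow> l (x + y) = l x + l y"
    and scale: "\<And>c x. x \<in> S \<Longrightarrow> l (c *\<^sub>R x) = c * l x"
    and bound: "\<And>x. x \<in> S \<Longrightarrow> \<bar>l x\<bar> \<le> K * norm x"
  obtains w where "\<And>x. x \<in> S \<Longrightarrow> w \<bullet> x = l x"
proof -
  define J where "J x = x \<bullet> x - 2 * l x" for x
  define d where "d = (INF x\<in>S. J x)"
  have S0: "0 \<in> S" and Sadd: "\<And>x y. x \<in> S \<Longrightarrow> y \<in> S \<Longrightarrow> x + y \<in> S"
    and Sscale: "\<And>c x. x \<in> S \<Longrightarrow> c *\<^sub>R x \<in> S"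
    using S by (auto simp: subspace_def)
  have "- (K\<^sup>2) \<le> J x" if "x \<in> S" for x
  proof -
    have "J x \<ge> (norm x)\<^sup>2 - 2 * (K * norm x)"
      using bound[OF that] by (simp add: J_def power2_norm_eq_inner)
    moreover have "(norm x)\<^sup>2 - 2 * (K * norm x) + K\<^sup>2 = (norm x - K)\<^sup>2"
      by (simp add: power2_diff)
    ultimately show ?thesis by (smt (verit) zero_le_power2)
  qed
  then have bdd: "bdd_below (J ` S)" by (intro bdd_belowI2)
  have d_le: "d \<le> J x" if "x \<in> S" for x
    unfolding d_def using bdd that by (rule cINF_lower)
  have "\<exists>x\<in>S. J x < d + inverse (real (Suc n))" for n
    using cINF_less_iff[OF _ bdd, of "d + inverse (real (Suc n))"] S0 unfolding d_def by auto
  then obtain x where xS: "\<And>n. x n \<in> S" and xJ: "\<And>n. J (x n) < d + inverse (real (Suc n))"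
    by metis
  have Jlim: "(\<lambda>n. J (x n)) \<longlonglongrightarrow> d"
  proof (rule tendsto_sandwich[where f="\<lambda>n. d" and h="\<lambda>n. d + inverse (real (Suc n))"])
    show "(\<lambda>n. d + inverse (real (Suc n))) \<longlonglongrightarrow> d"
      using tendsto_add[OF tendsto_const[of d] LIMSEQ_inverse_real_of_nat] by simp
  qed (intro always_eventually allI d_le xS, intro always_eventually allI less_imp_le xJ, simp)
  \<comment> \<open>Parallelogram law, with the midpoint in \<open>S\<close>: the linear part of
    \<open>J\<close> cancels in \<open>2 * J a + 2 * J b - 4 * J ((1/2) (a + b))\<close>.\<close>
  have para: "(norm (a - b))\<^sup>2 \<le> 2 * (J a - d) + 2 * (J b - d)" if "a \<in> S" "b \<in> S" for a b
  proof -
    have "d \<le> J ((1/2) *\<^sub>R (a + b))" by (intro d_le Sscale Sadd that)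
    moreover have "l ((1/2) *\<^sub>R (a + b)) = (l a + l b) / 2"
      using that by (simp only: scale Sadd add)
    ultimately show ?thesis
      unfolding J_def power2_norm_eq_inner
      by (simp add: inner_add_left inner_add_right inner_diff_left inner_diff_right inner_commute
          field_simps)
  qed
  have "Cauchy x"
  proof (rule metric_CauchyI)
    fix e :: real assume e: "0 < e"
    obtain N where N: "inverse (real (Suc N)) < e\<^sup>2 / 4"
      using reals_Archimedean[of "e\<^sup>2 / 4"] e by auto
    have small: "J (x n) - d < e\<^sup>2 / 4" if "n \<ge> N" for n
    proof -
      have "inverse (real (Suc n)) \<le> inverse (real (Suc N))" using that by simp
      then show ?thesis using xJ[of n] N by linarith
    qed
    have "dist (x m) (x n) < e" if "m \<ge> N" "n \<ge> N" for m n
    proof -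
      have "(norm (x m - x n))\<^sup>2 < e\<^sup>2"
        using para[OF xS xS, of m n] small[OF that(1)] small[OF that(2)] by argo
      then show ?thesis using e by (simp add: dist_norm power_less_imp_less_base)
    qed
    then show "\<exists>N. \<forall>m\<ge>N. \<forall>n\<ge>N. dist (x m) (x n) < e" by blast
  qed
  then obtain w where w: "x \<longlonglongrightarrow> w" by (meson Cauchy_convergent convergent_def)
  show thesis
  proof
    fix r assume r: "r \<in> S"
    define q where "q = w \<bullet> r - l r"
    \<comment> \<open>First variation of \<open>J\<close> in the direction \<open>r\<close>. Nothing
      is known about \<open>l w\<close>, so the expansion is done at \<open>x n\<close> and
      \<open>w\<close> enters only in the limit.\<close>
    have quad: "0 \<le> 2 * c * q + c\<^sup>2 * (r \<bullet> r)" for c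
    proof -
      have "J (x n + c *\<^sub>R r) = J (x n) + 2 * c * (x n \<bullet> r - l r) + c\<^sup>2 * (r \<bullet> r)" for n
        unfolding J_def by (simp add: add scale xS r Sscale inner_add_left inner_add_right
            inner_commute algebra_simps power2_eq_square)
      then have "d \<le> J (x n) + 2 * c * (x n \<bullet> r - l r) + c\<^sup>2 * (r \<bullet> r)" for n
        by (metis d_le xS r Sscale Sadd)
      moreover have "(\<lambda>n. J (x n) + 2 * c * (x n \<bullet> r - l r) + c\<^sup>2 * (r \<bullet> r))
          \<longlonglongrightarrow> d + 2 * c * q + c\<^sup>2 * (r \<bullet> r)"
        unfolding q_def by (intro tendsto_intros Jlim w)
      ultimately have "d \<le> d + 2 * c * q + c\<^sup>2 * (r \<bullet> r)"
        by (meson LIMSEQ_le_const)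
      then show ?thesis by simp
    qed
    \<comment> \<open>The quadratic in \<open>c\<close> is least at
      \<open>- q / (r \<bullet> r)\<close>; the added 1 permits \<open>r = 0\<close> and still makes
      the value negative unless \<open>q = 0\<close>.\<close>
    define N where "N = r \<bullet> r + 1"
    define c where "c = - q / N"
    have pos: "r \<bullet> r + 1 > 0" by (smt (verit) inner_ge_zero)
    then have cN: "c * N = - q" by (simp add: c_def N_def)
    have "0 \<le> (2 * c * q + c\<^sup>2 * (r \<bullet> r)) * N\<^sup>2"
      using quad by simp
    also have "\<dots> = 2 * (c * N) * q * N + (c * N)\<^sup>2 * (r \<bullet> r)"
      by (simp add: algebra_simps power2_eq_square)
    also have "\<dots> = - (q\<^sup>2 * (r \<bullet> r + 2))"
      unfolding cN by (simp add: N_def algebra_simps power2_eq_square)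
    finally have "q\<^sup>2 * (r \<bullet> r + 2) \<le> 0" by simp
    then have "q = 0" using pos by (simp add: mult_le_0_iff)
    then show "w \<bullet> r = l r" by (simp add: q_def)
  qed
qed

text \<open>\<open>B\<close> is the inverse of \<open>1 + A\<close>. The facts listed are all that
  the uniqueness argument uses of \<open>A\<close>.\<close>

lemma positive_selfadjoint_resolvent:
  fixes D :: "'h::{real_inner, complete_space} set"
  assumes sa: "selfadjoint D A" and pos: "positive_operator D A"
  obtains B where "bounded_linear B" "\<And>x y. B x \<bullet> y = x \<bullet> B y"
    "\<And>x. x \<noteq> 0 \<Longrightarrow> 0 < B x \<bullet> x" "\<And>x. B x \<bullet> x \<le> x \<bullet> x" "\<And>x. x \<in> D \<Longrightarrow> B (A x) = x - B x"
proof -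
  have sub: "subspace D" and Aadd: "\<And>x y. x \<in> D \<Longrightarrow> y \<in> D \<Longrightarrow> A (x + y) = A x + A y"
    and Ascale: "\<And>c x. x \<in> D \<Longrightarrow> A (c *\<^sub>R x) = c *\<^sub>R A x"
    and graph: "adjoint_graph D A = {(y, A y) |y. y \<in> D}"
    using sa by (auto simp: selfadjoint_def linear_operator_def)
  have D0: "0 \<in> D" and Dadd: "\<And>x y. x \<in> D \<Longrightarrow> y \<in> D \<Longrightarrow> x + y \<in> D"
    and Dscale: "\<And>c x. x \<in> D \<Longrightarrow> c *\<^sub>R x \<in> D"
    using sub by (auto simp: subspace_def)
  have A0: "A 0 = 0" using Ascale[OF D0, of 0] by simp
  have sym: "A x \<bullet> y = x \<bullet> A y" if "x \<in> D" "y \<in> D" for x y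
  proof -
    have "(y, A y) \<in> adjoint_graph D A" using graph that by auto
    then show ?thesis using that by (auto simp: adjoint_graph_def)
  qed
  have Apos: "0 \<le> A x \<bullet> x" if "x \<in> D" for x using pos that by (auto simp: positive_operator_def)
  define T where "T x = x + A x" for x
  have T_bound: "norm x \<le> norm (T x)" if "x \<in> D" for x
  proof -
    have "(norm x)\<^sup>2 \<le> T x \<bullet> x"
      using Apos[OF that] by (simp add: T_def inner_add_left power2_norm_eq_inner)
    also have "\<dots> \<le> norm (T x) * norm x" by (rule norm_cauchy_schwarz)
    finally have "norm x * norm x \<le> norm (T x) * norm x" by (simp add: power2_eq_square)
    then show ?thesis by (cases "norm x = 0") (auto simp: mult_le_cancel_right)
  qed
  have Tadd: "T (x + y) = T x + T y" if "x \<in> D" "y \<in> D" for x y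
    using that by (simp add: T_def Aadd)
  have Tscale: "T (c *\<^sub>R x) = c *\<^sub>R T x" if "x \<in> D" for c x
    using that by (simp add: T_def Ascale algebra_simps)
  have T_inj: "x = y" if "x \<in> D" "y \<in> D" "T x = T y" for x y
  proof -
    have "T (x + (-1) *\<^sub>R y) = T x + (-1) *\<^sub>R T y"
      by (simp only: Tadd[OF that(1) Dscale[OF that(2)]] Tscale[OF that(2)])
    also have "\<dots> = 0" using that by simp
    finally have "norm (x + (-1) *\<^sub>R y) \<le> 0"
      using T_bound[OF Dadd[OF that(1) Dscale[OF that(2)]], of "-1"] by (simp only: norm_zero)
    then show ?thesis by simp
  qed
  \<comment> \<open>By \<open>T_bound\<close>, sending \<open>T x\<close> to
    \<open>x \<bullet> h\<close> is a functional on the range of \<open>T\<close>, bounded by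
    \<open>norm h\<close>. A representing \<open>y\<close> satisfies
    \<open>T x \<bullet> y = x \<bullet> h\<close> on \<open>D\<close>, which puts \<open>y\<close>
    in the domain of the adjoint of \<open>A\<close>, that is in \<open>D\<close>, with
    \<open>T y = h\<close>.\<close>
  have T_surj: "\<exists>y\<in>D. T y = h" for h
  proof -
    define R where "R = inv_into D T"
    have inj: "inj_on T D" using T_inj by (auto simp: inj_on_def)
    have R: "R (T x) = x" if "x \<in> D" for x
      unfolding R_def using inj that by simp
    have "subspace (T ` D)"
      unfolding subspace_def
    proof (intro conjI ballI allI)
      show "0 \<in> T ` D" using D0 A0 by (auto simp: T_def image_iff intro!: bexI[of _ 0])
    qed (auto simp flip: Tadd Tscale intro: Dadd Dscale)
    then obtain y where y: "\<And>r. r \<in> T ` D \<Longrightarrow> y \<bullet> r = R r \<bullet> h"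
    proof (rule riesz_on_subspace[of "T ` D" "\<lambda>r. R r \<bullet> h" "norm h"])
      show "R (a + b) \<bullet> h = R a \<bullet> h + R b \<bullet> h" if "a \<in> T ` D" "b \<in> T ` D" for a b
        using that by (auto simp: R inner_add_left Dadd simp flip: Tadd)
      show "R (c *\<^sub>R a) \<bullet> h = c * (R a \<bullet> h)" if "a \<in> T ` D" for c a
        using that by (auto simp: R Dscale simp flip: Tscale)
      show "\<bar>R a \<bullet> h\<bar> \<le> norm h * norm a" if "a \<in> T ` D" for a
      proof -
        from that obtain x where x: "x \<in> D" "a = T x" by auto
        have "\<bar>x \<bullet> h\<bar> \<le> norm x * norm h" by (rule Cauchy_Schwarz_ineq2)
        also have "\<dots> \<le> norm (T x) * norm h" by (intro mult_right_mono T_bound x) simp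
        finally show ?thesis using x by (simp add: R mult.commute)
      qed
    qed auto
    have "A x \<bullet> y = x \<bullet> (h - y)" if "x \<in> D" for x
      using y[OF imageI[OF that]] unfolding R[OF that]
      by (simp add: T_def inner_add_right inner_diff_right inner_commute)
    then have "(y, h - y) \<in> adjoint_graph D A" by (simp add: adjoint_graph_def)
    then have "y \<in> D" "h - y = A y" using graph by auto
    then show ?thesis by (intro bexI[of _ y]) (auto simp: T_def algebra_simps)
  qed
  define B where "B h = (SOME y. y \<in> D \<and> T y = h)" for h
  have B: "B h \<in> D" "T (B h) = h" for h
    using someI_ex[of "\<lambda>y. y \<in> D \<and> T y = h"] T_surj[of h] unfolding B_def by auto
  have BT: "B (T x) = x" if "x \<in> D" for x
    using T_inj[OF B(1) that] B(2) by simp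
  show thesis
  proof (rule that[of B])
    show "bounded_linear B"
    proof (rule bounded_linear_intro[where K=1])
      show "B (x + y) = B x + B y" for x y
        by (rule T_inj) (simp_all add: B Tadd Dadd)
      show "B (c *\<^sub>R x) = c *\<^sub>R B x" for c x
        by (rule T_inj) (simp_all add: B Tscale Dscale)
      show "norm (B x) \<le> norm x * 1" for x
        using T_bound[OF B(1), of x] by (simp add: B)
    qed
    show "B x \<bullet> y = x \<bullet> B y" for x y
    proof -
      have "B x \<bullet> T (B y) = T (B x) \<bullet> B y"
        by (simp add: T_def inner_add_left inner_add_right sym B)
      then show ?thesis by (simp add: B)
    qed
    show "0 < B x \<bullet> x" if "x \<noteq> 0" for x
    proof -
      have "B x \<noteq> 0" using that B(2)[of x] A0 by (auto simp: T_def)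
      then have "0 < B x \<bullet> B x" by simp
      also have "\<dots> \<le> T (B x) \<bullet> B x" using Apos[OF B(1)] by (simp add: T_def inner_add_left)
      finally show ?thesis by (simp add: B inner_commute)
    qed
    \<comment> \<open>With \<open>y = B x\<close>, so that \<open>x = T y\<close>, the gap is
      \<open>A y \<bullet> y + A y \<bullet> A y\<close>.\<close>
    show "B x \<bullet> x \<le> x \<bullet> x" for x
    proof -
      have "0 \<le> A (B x) \<bullet> B x + A (B x) \<bullet> A (B x)" using Apos[OF B(1)] by simp
      also have "\<dots> = T (B x) \<bullet> T (B x) - B x \<bullet> T (B x)"
        by (simp add: T_def inner_add_left inner_add_right inner_commute)
      finally show ?thesis by (simp add: B)
    qed
    show "B (A x) = x - B x" if "x \<in> D" for x
    proof -
      have "x - B x \<in> D" by (rule subspace_diff[OF sub that B(1)])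
      moreover have "T (x - B x) = A x"
      proof -
        have "T (x + (-1) *\<^sub>R B x) = T x + (-1) *\<^sub>R T (B x)"
          by (simp only: Tadd[OF that Dscale[OF B(1)]] Tscale[OF B(1)])
        then show ?thesis by (simp add: B) (simp add: T_def)
      qed
      ultimately show ?thesis using BT by metis
    qed
  qed
qed

section \<open>Energy estimates for the radial wave operator\<close>

lemma at_within_nonneg: "at s within {0..} = at s" if "0 < s" for s :: real
  by (rule at_within_open_subset[of s "{0<..}"]) (use that in auto)

text \<open>The derivative of s^(2 lam) v' is s^(2 lam) (v'' + (2 lam/s) v'), but integrating from 0
  would need control of \<open>v1\<close> near 0. A Darboux-type argument replaces it: an excess
  \<open>d\<close> at \<open>t\<close> propagates, in the fixed direction \<open>e\<close>, to every
  smaller \<open>s\<close>, so the difference quotients of \<open>v\<close> at 0 stay above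
  \<open>d\<close>, against \<open>v1 0 = 0\<close>.\<close>

lemma radial_derivative_bound:
  fixes v v1 v2 :: "real \<Rightarrow> 'h::real_inner"
  assumes v: "\<And>s. 0 \<le> s \<Longrightarrow> (v has_vector_derivative v1 s) (at s within {0..})"
    and v1: "\<And>s. 0 < s \<Longrightarrow> (v1 has_vector_derivative v2 s) (at s)"
    and v10: "v1 0 = 0" and lam: "0 \<le> lam" and t: "0 < t" and K: "0 \<le> K"
    and bound: "\<And>s. 0 < s \<Longrightarrow> s \<le> t \<Longrightarrow> norm (v2 s + (2 * lam / s) *\<^sub>R v1 s) \<le> K"
  shows "norm (v1 t) \<le> K * t"
proof (rule ccontr)
  assume neg: "\<not> ?thesis"
  define d where "d = norm (v1 t) - K * t"
  then have d: "0 < d" using neg by simp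
  define e where "e = v1 t /\<^sub>R norm (v1 t)"
  have nz: "norm (v1 t) > 0" using d K t unfolding d_def by (smt (verit) mult_nonneg_nonneg)
  have e1: "norm e = 1" using nz by (simp add: e_def)
  have te: "v1 t \<bullet> e = norm (v1 t)" using nz by (simp add: e_def dot_square_norm power2_eq_square)
  have low: "d \<le> v1 s \<bullet> e" if s: "0 < s" "s < t" for s
  proof -
    define \<phi> where "\<phi> r = r powr (2 * lam) * (v1 r \<bullet> e)" for r
    have "\<exists>r. s < r \<and> r < t \<and> \<phi> t - \<phi> s = (t - s) *
        (r powr (2 * lam) * ((v2 r + (2 * lam / r) *\<^sub>R v1 r) \<bullet> e))"
    proof (rule MVT2)
      fix r assume r: "s \<le> r" "r \<le> t"
      have "(v1 has_derivative (\<lambda>h. h *\<^sub>R v2 r)) (at r)"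
        using v1[of r] r s by (simp add: has_vector_derivative_def)
      then have "((\<lambda>r. v1 r \<bullet> e) has_derivative (\<lambda>h. (h *\<^sub>R v2 r) \<bullet> e)) (at r)"
        by (rule has_derivative_inner_left)
      then have d1: "((\<lambda>r. v1 r \<bullet> e) has_real_derivative (v2 r \<bullet> e)) (at r)"
        unfolding has_field_derivative_def
        by (rule has_derivative_eq_rhs) (simp add: fun_eq_iff mult.commute)
      have "r > 0" using r s by simp
      then show "(\<phi> has_real_derivative r powr (2 * lam) * ((v2 r + (2 * lam / r) *\<^sub>R v1 r) \<bullet> e)) (at r)"
        unfolding \<phi>_def
        by (auto intro!: derivative_eq_intros d1 simp: inner_add_left powr_diff divide_simps)
          (simp add: algebra_simps)
    qed (use s in auto)
    then obtain r where r: "s < r" "r < t" and eq: "\<phi> t - \<phi> s = (t - s) *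
        (r powr (2 * lam) * ((v2 r + (2 * lam / r) *\<^sub>R v1 r) \<bullet> e))" by blast
    have "(v2 r + (2 * lam / r) *\<^sub>R v1 r) \<bullet> e \<le> K"
      using norm_cauchy_schwarz[of "v2 r + (2 * lam / r) *\<^sub>R v1 r" e] bound[of r] r s e1 by simp
    then have "r powr (2 * lam) * ((v2 r + (2 * lam / r) *\<^sub>R v1 r) \<bullet> e) \<le> t powr (2 * lam) * K"
      using r s K lam by (meson mult_left_mono mult_right_mono order_trans powr_ge_zero powr_mono2
          less_imp_le mult_nonneg_nonneg zero_le_numeral less_trans)
    then have "\<phi> t - \<phi> s \<le> (t - s) * (t powr (2 * lam) * K)"
      unfolding eq using s by (intro mult_left_mono) auto
    also have "\<dots> \<le> t * (t powr (2 * lam) * K)" using s K by (intro mult_right_mono) auto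
    \<comment> \<open>Between \<open>s\<close> and \<open>t\<close> the function
      \<open>\<phi>\<close> grows by at most \<open>t * (t powr (2 * lam) * K)\<close>; what is left
      of \<open>\<phi> t\<close> is the excess \<open>d\<close> times the weight at
      \<open>t\<close>.\<close>
    finally have ge: "t powr (2 * lam) * d \<le> s powr (2 * lam) * (v1 s \<bullet> e)"
      unfolding \<phi>_def d_def te by (simp add: algebra_simps)
    have "s powr (2 * lam) * d \<le> t powr (2 * lam) * d"
      using s lam d by (intro mult_right_mono powr_mono2) auto
    with ge have "s powr (2 * lam) * d \<le> s powr (2 * lam) * (v1 s \<bullet> e)" by linarith
    then show ?thesis using s by (simp add: mult_le_cancel_left)
  qed
  have inc: "d \<le> ((1 / norm s) *\<^sub>R (v s - v 0)) \<bullet> e" if s: "0 < s" "s < t" for s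
  proof -
    have contv: "continuous_on {0..s} v"
      unfolding continuous_on_eq_continuous_within
    proof
      fix r assume "r \<in> {0..s}"
      then have "continuous (at r within {0..}) v"
        using v[of r] has_vector_derivative_continuous by auto
      then show "continuous (at r within {0..s}) v"
        by (rule continuous_within_subset) auto
    qed
    have "\<exists>r. 0 < r \<and> r < s \<and> v s \<bullet> e - v 0 \<bullet> e = (\<lambda>h. h * (v1 r \<bullet> e)) (s - 0)"
    proof (rule mvt[of 0 s "\<lambda>r. v r \<bullet> e" "\<lambda>r h. h * (v1 r \<bullet> e)", simplified])
      show "continuous_on {0..s} (\<lambda>r. v r \<bullet> e)" by (intro continuous_intros contv)
      fix r assume r: "0 < r" "r < s"
      have "(v has_vector_derivative v1 r) (at r)"
        using v[of r] r at_within_nonneg[of r] by simp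
      then have "((\<lambda>r. v r \<bullet> e) has_derivative (\<lambda>h. (h *\<^sub>R v1 r) \<bullet> e)) (at r)"
        unfolding has_vector_derivative_def by (rule has_derivative_inner_left)
      then show "((\<lambda>r. v r \<bullet> e) has_derivative (\<lambda>h. h * (v1 r \<bullet> e))) (at r)" by simp
    qed (use s in auto)
    then obtain r where r: "0 < r" "r < s" "v s \<bullet> e - v 0 \<bullet> e = s * (v1 r \<bullet> e)" by auto
    have "s * d \<le> s * (v1 r \<bullet> e)" using low[of r] r s by (intro mult_left_mono) auto
    then show ?thesis using r s by (simp add: inner_diff_left field_simps)
  qed
  have "((\<lambda>s. (1 / norm s) *\<^sub>R (v s - v 0)) \<longlongrightarrow> 0) (at 0 within {0..})"
    using v[of 0] v10 by (simp add: has_vector_derivative_def has_derivative_within)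
  then have "((\<lambda>s. ((1 / norm s) *\<^sub>R (v s - v 0)) \<bullet> e) \<longlongrightarrow> 0 \<bullet> e) (at_right 0)"
    by (intro tendsto_inner tendsto_const) (auto intro: tendsto_within_subset)
  moreover have "\<forall>\<^sub>F s in at_right 0. d \<le> ((1 / norm s) *\<^sub>R (v s - v 0)) \<bullet> e"
    using eventually_at_right_real[OF t] by eventually_elim (rule inc, auto)
  ultimately have "d \<le> 0 \<bullet> e" by (intro tendsto_lowerbound) auto
  with d show False by simp
qed

text \<open>The damping term makes the derivative of the energy
  \<open>- (4 * lam / s) * (P (v1 s) \<bullet> v1 s)\<close>, which is nonpositive. \<open>P\<close>
  and \<open>Q\<close> will be \<open>B\<close> and \<open>C\<close> for uniqueness, the identity
  and a multiple of it for the scalar equation.\<close>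

lemma EPD_energy_le:
  fixes v v1 v2 :: "real \<Rightarrow> 'h::real_inner"
  assumes v: "\<And>s. 0 < s \<Longrightarrow> (v has_vector_derivative v1 s) (at s)"
    and v1: "\<And>s. 0 < s \<Longrightarrow> (v1 has_vector_derivative v2 s) (at s)"
    and eq: "\<And>s. 0 < s \<Longrightarrow> P (v2 s) + (2 * lam / s) *\<^sub>R P (v1 s) + Q (v s) = 0"
    and P: "bounded_linear P" "\<And>x y. P x \<bullet> y = x \<bullet> P y" "\<And>x. 0 \<le> P x \<bullet> x"
    and Q: "bounded_linear Q" "\<And>x y. Q x \<bullet> y = x \<bullet> Q y"
    and lim: "(v \<longlongrightarrow> a) (at_right 0)" "(v1 \<longlongrightarrow> 0) (at_right 0)"
    and lam: "0 \<le> lam" and t: "0 < t"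
  shows "P (v1 t) \<bullet> v1 t + Q (v t) \<bullet> v t \<le> Q a \<bullet> a"
proof -
  define E where "E s = P (v1 s) \<bullet> v1 s + Q (v s) \<bullet> v s" for s
  have dE: "(E has_real_derivative - ((4 * lam / s) * (P (v1 s) \<bullet> v1 s))) (at s)" if s: "0 < s" for s
  proof -
    have 1: "(v1 has_derivative (\<lambda>h. h *\<^sub>R v2 s)) (at s)" "(v has_derivative (\<lambda>h. h *\<^sub>R v1 s)) (at s)"
      using v v1 s by (auto simp: has_vector_derivative_def)
    have 2: "(E has_derivative (\<lambda>h. (P (v1 s) \<bullet> (h *\<^sub>R v2 s) + P (h *\<^sub>R v2 s) \<bullet> v1 s)
        + (Q (v s) \<bullet> (h *\<^sub>R v1 s) + Q (h *\<^sub>R v1 s) \<bullet> v s))) (at s)"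
      unfolding E_def
      by (intro has_derivative_add has_derivative_inner 1
          bounded_linear.has_derivative[OF P(1)] bounded_linear.has_derivative[OF Q(1)])
    have "P (v2 s) = - (2 * lam / s) *\<^sub>R P (v1 s) - Q (v s)"
      using eq[OF s] by (simp add: algebra_simps eq_neg_iff_add_eq_0)
    then have 3: "P (v2 s) \<bullet> v1 s = - (2 * lam / s) * (P (v1 s) \<bullet> v1 s) - Q (v s) \<bullet> v1 s"
      by (simp add: inner_diff_left)
    have 4: "P (v1 s) \<bullet> v2 s = P (v2 s) \<bullet> v1 s" by (metis P(2) inner_commute)
    have 5: "Q (v1 s) \<bullet> v s = Q (v s) \<bullet> v1 s" by (metis Q(2) inner_commute)
    show ?thesis
      unfolding has_field_derivative_def
      by (rule has_derivative_eq_rhs[OF 2])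
        (auto simp: fun_eq_iff linear_cmul[OF bounded_linear.linear[OF P(1)]]
          linear_cmul[OF bounded_linear.linear[OF Q(1)]] 3 4 5 algebra_simps)
  qed
  have mono: "E t \<le> E s" if s: "0 < s" "s \<le> t" for s
  proof (rule DERIV_nonpos_imp_nonincreasing[OF s(2)])
    fix r assume "s \<le> r" "r \<le> t"
    then show "\<exists>y. (E has_real_derivative y) (at r) \<and> y \<le> 0"
      using s lam P(3) dE[of r]
      by (intro exI conjI, assumption?) (auto intro!: divide_nonneg_pos mult_nonneg_nonneg)
  qed
  have "(E \<longlongrightarrow> P 0 \<bullet> 0 + Q a \<bullet> a) (at_right 0)"
    unfolding E_def
    by (intro tendsto_intros lim bounded_linear.tendsto[OF P(1)] bounded_linear.tendsto[OF Q(1)])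
  moreover have "\<forall>\<^sub>F s in at_right 0. E t \<le> E s"
    using eventually_at_right_real[OF t] by eventually_elim (rule mono, auto)
  ultimately have "E t \<le> P 0 \<bullet> 0 + Q a \<bullet> a" by (intro tendsto_lowerbound) auto
  then show ?thesis by (simp add: E_def)
qed

section \<open>Weak and Bochner integrals\<close>

text \<open>The Pettis integral: linear identities between vector integrals become real ones, one
  test vector at a time.\<close>

definition weak_integral :: "'a measure \<Rightarrow> ('a \<Rightarrow> 'h::real_inner) \<Rightarrow> 'h \<Rightarrow> bool" where
  "weak_integral M g I \<longleftrightarrow> (\<forall>e. has_bochner_integral M (\<lambda>x. g x \<bullet> e) (I \<bullet> e))"

lemma weak_integral_unique: "I = J" if "weak_integral M g I" "weak_integral M g J"
proof -
  have "(I - J) \<bullet> e = 0" for e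
    using that has_bochner_integral_eq[of M "\<lambda>x. g x \<bullet> e"] unfolding weak_integral_def
    by (simp add: inner_diff_left)
  then have "(I - J) \<bullet> (I - J) = 0" by blast
  then show ?thesis by simp
qed

lemma weak_integral_diff:
  "weak_integral M g I \<Longrightarrow> weak_integral M h J \<Longrightarrow> weak_integral M (\<lambda>x. g x - h x) (I - J)"
  by (simp add: weak_integral_def inner_diff_left has_bochner_integral_diff)

lemma weak_integral_scaleR:
  "weak_integral M g I \<Longrightarrow> weak_integral M (\<lambda>x. c *\<^sub>R g x) (c *\<^sub>R I)"
  by (simp add: weak_integral_def has_bochner_integral_mult_right)

lemma weak_integral_symmetric:
  assumes "weak_integral M g I" "\<And>x y. B x \<bullet> y = x \<bullet> B y"
  shows "weak_integral M (\<lambda>x. B (g x)) (B I)"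
  using assms by (simp add: weak_integral_def)

text \<open>Test against \<open>I\<close> itself. The majorant \<open>b\<close> stands in for
  \<open>norm (g x)\<close>, whose measurability does not follow from that of the inner
  products.\<close>

lemma weak_integral_norm_le:
  assumes I: "weak_integral M g I" and b: "integrable M b"
    and le: "\<And>x. x \<in> space M \<Longrightarrow> norm (g x) \<le> b x"
  shows "norm I \<le> integral\<^sup>L M b"
proof -
  have hb: "has_bochner_integral M (\<lambda>x. g x \<bullet> I) (I \<bullet> I)"
    using I by (simp add: weak_integral_def)
  have "I \<bullet> I = (\<integral>x. g x \<bullet> I \<partial>M)" using has_bochner_integral_integral_eq[OF hb] by simp
  also have "\<dots> \<le> (\<integral>x. b x * norm I \<partial>M)"
  proof (rule integral_mono)
    show "integrable M (\<lambda>x. g x \<bullet> I)" using hb by (rule integrable.intros)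
    fix x assume "x \<in> space M"
    then show "g x \<bullet> I \<le> b x * norm I"
      using norm_cauchy_schwarz[of "g x" I] mult_right_mono[OF le, of x "norm I"] by simp
  qed (use b in simp)
  also have "\<dots> = (\<integral>x. b x \<partial>M) * norm I" by simp
  finally have "norm I * norm I \<le> (\<integral>x. b x \<partial>M) * norm I"
    by (simp add: dot_square_norm power2_eq_square)
  moreover have "0 \<le> (\<integral>x. b x \<partial>M)"
    by (rule integral_nonneg_AE) (use le in \<open>force intro: AE_I2 order_trans[OF norm_ge_zero]\<close>)
  ultimately show ?thesis by (cases "norm I = 0") (auto simp: mult_le_cancel_right)
qed

lemma weak_integral_exists:
  fixes g :: "'a \<Rightarrow> 'h::{real_inner, complete_space}"
  assumes b: "integrable M b" and le: "\<And>x. x \<in> space M \<Longrightarrow> norm (g x) \<le> b x"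
    and meas: "\<And>e. (\<lambda>x. g x \<bullet> e) \<in> borel_measurable M"
  obtains I where "weak_integral M g I"
proof -
  have le': "norm (g x \<bullet> e) \<le> b x * norm e" if "x \<in> space M" for x e
    using Cauchy_Schwarz_ineq2[of "g x" e] mult_right_mono[OF le[OF that], of "norm e"] by simp
  have int: "integrable M (\<lambda>x. g x \<bullet> e)" for e
  proof (rule Bochner_Integration.integrable_bound)
    show "integrable M (\<lambda>x. b x * norm e)" using b by simp
    show "AE x in M. norm (g x \<bullet> e) \<le> norm (b x * norm e)"
      by (intro AE_I2 order_trans[OF le']) simp_all
  qed (rule meas)
  obtain I where I: "\<And>e. e \<in> UNIV \<Longrightarrow> I \<bullet> e = (\<integral>x. g x \<bullet> e \<partial>M)"
  proof (rule riesz_on_subspace[of "UNIV :: 'h set" "\<lambda>e. \<integral>x. g x \<bullet> e \<partial>M" "integral\<^sup>L M b"])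
    show "\<bar>\<integral>x. g x \<bullet> e \<partial>M\<bar> \<le> integral\<^sup>L M b * norm e" for e
    proof -
      have "\<bar>\<integral>x. g x \<bullet> e \<partial>M\<bar> \<le> (\<integral>x. \<bar>g x \<bullet> e\<bar> \<partial>M)" by (rule integral_abs_bound)
      also have "\<dots> \<le> (\<integral>x. b x * norm e \<partial>M)"
        using le' by (intro integral_mono integrable_abs int) (use b in auto)
      finally show ?thesis by simp
    qed
  qed (auto simp: inner_add_right int)
  show thesis
    by (rule that[of I]) (auto simp: weak_integral_def I has_bochner_integral_iff int)
qed

section \<open>Bochner integrals are weak integrals\<close>

lemma has_bochner_cong:
  assumes "\<And>x. x \<in> space M \<Longrightarrow> g x = h x"
  shows "has_bochner M g I \<longleftrightarrow> has_bochner M h I"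
proof -
  have "g \<in> borel_measurable M \<longleftrightarrow> h \<in> borel_measurable M"
    by (rule measurable_cong) (rule assms)
  moreover have "(\<integral>\<^sup>+x. ennreal (norm (g x - s x)) \<partial>M) = (\<integral>\<^sup>+x. ennreal (norm (h x - s x)) \<partial>M)" for s
    by (rule nn_integral_cong) (simp add: assms)
  ultimately show ?thesis by (simp add: has_bochner_def)
qed

lemma has_bochner_imp_weak_integral:
  fixes g :: "'a \<Rightarrow> 'h::real_inner"
  assumes "has_bochner M g I"
  shows "weak_integral M g I"
  unfolding weak_integral_def
proof
  fix e :: 'h
  from assms obtain s where g: "g \<in> borel_measurable M"
    and s: "\<And>i. Bochner_Integration.simple_bochner_integrable M (s i)"
    and lim: "(\<lambda>i. \<integral>\<^sup>+x. ennreal (norm (g x - s i x)) \<partial>M) \<longlonglongrightarrow> 0"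
    and S: "(\<lambda>i. Bochner_Integration.simple_bochner_integral M (s i)) \<longlonglongrightarrow> I"
    unfolding has_bochner_def by auto
  have lin: "linear (\<lambda>x. x \<bullet> e)" by (simp add: bounded_linear.linear bounded_linear_inner_left)
  show "has_bochner_integral M (\<lambda>x. g x \<bullet> e) (I \<bullet> e)"
  proof (rule has_bochner_integral.intros[where s="\<lambda>i x. s i x \<bullet> e"])
    have "(\<lambda>x. x \<bullet> e) \<in> borel_measurable borel"
      by (intro borel_measurable_continuous_onI continuous_intros)
    then show "(\<lambda>x. g x \<bullet> e) \<in> borel_measurable M" using g by measurable
    show "Bochner_Integration.simple_bochner_integrable M (\<lambda>x. s i x \<bullet> e)" for i
      using simple_bochner_integrable_compose2[of "\<lambda>x y. x \<bullet> e", OF _ s s] by simp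
    show "(\<lambda>i. Bochner_Integration.simple_bochner_integral M (\<lambda>x. s i x \<bullet> e)) \<longlonglongrightarrow> I \<bullet> e"
      unfolding simple_bochner_integral_linear[OF lin s] by (intro tendsto_intros S)
    show "(\<lambda>i. \<integral>\<^sup>+x. ennreal (norm (g x \<bullet> e - s i x \<bullet> e)) \<partial>M) \<longlonglongrightarrow> 0"
    proof (rule tendsto_sandwich[where f="\<lambda>_. 0"])
      have "(\<integral>\<^sup>+x. ennreal (norm (g x \<bullet> e - s i x \<bullet> e)) \<partial>M)
          \<le> ennreal (norm e) * (\<integral>\<^sup>+x. ennreal (norm (g x - s i x)) \<partial>M)" for i
      proof -
        have sf: "simple_function M (s i)" using s by (auto elim: simple_bochner_integrable.cases)
        \<comment> \<open>In a nonseparable \<open>'h\<close> the difference of two Borel functions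
          need not be Borel. Since \<open>s i\<close> takes finitely many values, it is enough to
          freeze its value at a constant \<open>c\<close>.\<close>
        have "(\<lambda>x. norm (g x - s i x)) \<in> borel_measurable M"
        proof (rule measurable_compose_countable'[where g="s i" and I="s i ` space M"
              and f="\<lambda>c x. norm (g x - c)"])
          fix c :: 'h
          have "(\<lambda>x. norm (x - c)) \<in> borel_measurable borel"
            by (intro borel_measurable_continuous_onI continuous_intros)
          then show "(\<lambda>x. norm (g x - c)) \<in> borel_measurable M" using g by measurable
        next
          show "countable (s i ` space M)"
            using sf by (simp add: simple_function_def countable_finite)
          show "s i \<in> measurable M (count_space (s i ` space M))"
            using sf by (auto intro!: measurable_count_space_eq2[THEN iffD2]
                simp: simple_function_def)
        qed
        then show ?thesis
          by (subst nn_integral_cmult[symmetric])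
            (auto intro!: nn_integral_mono simp flip: ennreal_mult inner_diff_left
              simp: Cauchy_Schwarz_ineq2 mult.commute[of "norm e"])
      qed
      then show "\<forall>\<^sub>F i in sequentially. (\<integral>\<^sup>+x. ennreal (norm (g x \<bullet> e - s i x \<bullet> e)) \<partial>M)
          \<le> ennreal (norm e) * (\<integral>\<^sup>+x. ennreal (norm (g x - s i x)) \<partial>M)" by simp
      show "(\<lambda>i. ennreal (norm e) * (\<integral>\<^sup>+x. ennreal (norm (g x - s i x)) \<partial>M)) \<longlonglongrightarrow> 0"
        using ennreal_tendsto_cmult[OF _ lim, of "ennreal (norm e)"] by simp
    qed auto
  qed
qed

lemma bochner_integral_eq:
  fixes g :: "'a \<Rightarrow> 'h::real_inner"
  shows "has_bochner M g I \<Longrightarrow> bochner_integral M g = I"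
  unfolding bochner_integral_def
  by (rule the_equality) (auto intro: weak_integral_unique has_bochner_imp_weak_integral)

lemma simple_bochner_imp_weak_integral:
  fixes s :: "'a \<Rightarrow> 'h::real_inner"
  assumes s: "Bochner_Integration.simple_bochner_integrable M s"
  shows "weak_integral M s (Bochner_Integration.simple_bochner_integral M s)"
  unfolding weak_integral_def
proof
  fix e :: 'h
  have lin: "linear (\<lambda>x. x \<bullet> e)" by (simp add: bounded_linear.linear bounded_linear_inner_left)
  have "Bochner_Integration.simple_bochner_integrable M (\<lambda>x. s x \<bullet> e)"
    using simple_bochner_integrable_compose2[of "\<lambda>x y. x \<bullet> e", OF _ s s] by simp
  from has_bochner_integral_simple_bochner_integrable[OF this]
  show "has_bochner_integral M (\<lambda>x. s x \<bullet> e) (Bochner_Integration.simple_bochner_integral M s \<bullet> e)"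
    by (simp add: simple_bochner_integral_linear[OF lin s])
qed

section \<open>Strong integrability of a kernel times a continuous path\<close>

abbreviation "Ioo01 \<equiv> lebesgue_on {0<..<1::real}"

lemma measurable_Ioo01: "continuous_on {0<..<1} f \<Longrightarrow> f \<in> borel_measurable Ioo01"
  by (rule continuous_imp_measurable_on_sets_lebesgue) auto

text \<open>The kernel is approximated in L1 by simple functions \<open>s n\<close>, the path by its
  values at grid points; the products \<open>q n\<close> are simple and converge in L1. Because
  \<open>I\<close> is known in advance, the integrals of \<open>q n\<close> are compared with it
  directly, by \<open>weak_integral_norm_le\<close>.\<close>

lemma weak_integral_imp_has_bochner:
  fixes \<phi> :: "real \<Rightarrow> 'h::real_inner"
  assumes \<kappa>: "integrable Ioo01 \<kappa>" "continuous_on {0<..<1} \<kappa>"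
    and \<phi>: "continuous_on {0..1} \<phi>"
    and I: "weak_integral Ioo01 (\<lambda>y. \<kappa> y *\<^sub>R \<phi> y) I"
  shows "has_bochner Ioo01 (\<lambda>y. \<kappa> y *\<^sub>R \<phi> y) I"
proof -
  let ?M = "Ioo01"
  from \<kappa>(1) obtain J where "has_bochner_integral ?M \<kappa> J" by (auto elim: integrable.cases)
  then obtain s where s: "\<And>i. Bochner_Integration.simple_bochner_integrable ?M (s i)"
    and slim: "(\<lambda>i. \<integral>\<^sup>+x. ennreal (norm (\<kappa> x - s i x)) \<partial>?M) \<longlonglongrightarrow> 0"
    by (cases rule: has_bochner_integral.cases) blast
  have sint: "integrable ?M (s i)" for i
    using has_bochner_integral_simple_bochner_integrable[OF s] by (rule integrable.intros)
  define a where "a i = (\<integral>x. \<bar>\<kappa> x - s i x\<bar> \<partial>?M)" for i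
  define A where "A = (\<integral>x. \<bar>\<kappa> x\<bar> \<partial>?M)"
  have a: "a \<longlonglongrightarrow> 0"
  proof -
    have "(\<integral>\<^sup>+x. ennreal (norm (\<kappa> x - s i x)) \<partial>?M) = ennreal (a i)" for i
      unfolding a_def using nn_integral_eq_integral[of ?M "\<lambda>x. \<bar>\<kappa> x - s i x\<bar>"] \<kappa>(1) sint by simp
    with slim have "(\<lambda>i. ennreal (a i)) \<longlonglongrightarrow> ennreal 0" by simp
    then show ?thesis by (rule tendsto_ennrealD) (simp_all add: a_def)
  qed
  have comp: "compact (\<phi> ` {0..1})" by (intro compact_continuous_image \<phi>) simp
  then obtain K where K: "\<And>y. y \<in> {0..1} \<Longrightarrow> norm (\<phi> y) \<le> K"
    using compact_imp_bounded[OF comp] unfolding bounded_iff by (meson imageI)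
  \<comment> \<open>Rounding down to the grid of mesh \<open>1 / Suc n\<close>; the grid point can
    be 0, where \<open>\<phi>\<close> is continuous too.\<close>
  define r where "r n y = real_of_int \<lfloor>real (Suc n) * y\<rfloor> / real (Suc n)" for n y
  have r: "r n y \<in> {0..1}" "\<bar>y - r n y\<bar> \<le> 1 / real (Suc n)" if "y \<in> {0<..<1}" for n y
  proof -
    define N z where "N = real (Suc n)" and "z = real_of_int \<lfloor>N * y\<rfloor>"
    have N: "0 < N" "0 \<le> N * y" "N * y \<le> N" using that by (auto simp: N_def mult_le_cancel_left1)
    then have z: "0 \<le> z" "z \<le> N * y" "N * y - z \<le> 1" unfolding z_def by (simp, linarith+)
    have "y - z / N = (N * y - z) / N" using N by (simp add: field_simps)
    moreover have "\<bar>(N * y - z) / N\<bar> \<le> 1 / N" using N z by (simp add: divide_right_mono)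
    moreover have "0 \<le> z / N" "z / N \<le> 1" using N(1) z(1) order_trans[OF z(2) N(3)] by simp_all
    moreover have "r n y = z / N" by (simp only: r_def N_def z_def)
    ultimately show "r n y \<in> {0..1}" "\<bar>y - r n y\<bar> \<le> 1 / real (Suc n)"
      by (simp_all only: N_def atLeastAtMost_iff)
  qed
  \<comment> \<open>Largest deviation caused by the rounding; uniform continuity of
    \<open>\<phi>\<close> sends it to 0.\<close>
  define \<omega> where "\<omega> n = (SUP y\<in>{0<..<1}. norm (\<phi> y - \<phi> (r n y)))" for n
  have bdd: "bdd_above ((\<lambda>y. norm (\<phi> y - \<phi> (r n y))) ` {0<..<1})" for n
  proof (rule bdd_aboveI2)
    fix y :: real assume y: "y \<in> {0<..<1}"
    show "norm (\<phi> y - \<phi> (r n y)) \<le> K + K"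
      by (intro order_trans[OF norm_triangle_ineq4] add_mono K r y) (use y in auto)
  qed
  have \<omega>_upper: "norm (\<phi> y - \<phi> (r n y)) \<le> \<omega> n" if "y \<in> {0<..<1}" for y n
    unfolding \<omega>_def using that bdd by (rule cSUP_upper)
  have \<omega>: "\<omega> \<longlonglongrightarrow> 0"
  proof (rule metric_LIMSEQ_I)
    fix e :: real assume e: "0 < e"
    have "uniformly_continuous_on {0..1} \<phi>" by (intro compact_uniformly_continuous \<phi>) simp
    then obtain d where d: "0 < d"
      and dd: "\<And>x y. x \<in> {0..1} \<Longrightarrow> y \<in> {0..1} \<Longrightarrow> dist y x < d \<Longrightarrow> dist (\<phi> y) (\<phi> x) < e / 2"
      unfolding uniformly_continuous_on_def using e half_gt_zero by metis
    obtain N where N: "inverse (real (Suc N)) < d" using reals_Archimedean[OF d] by auto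
    have "dist (\<omega> n) 0 < e" if "n \<ge> N" for n
    proof -
      have "inverse (real (Suc n)) \<le> inverse (real (Suc N))" using that by simp
      then have small: "1 / real (Suc n) < d" using N by (simp add: inverse_eq_divide)
      have "\<omega> n \<le> e / 2"
        unfolding \<omega>_def
      proof (rule cSUP_least)
        fix y :: real assume y: "y \<in> {0<..<1}"
        then show "norm (\<phi> y - \<phi> (r n y)) \<le> e / 2"
          using dd[OF r(1)[OF y, of n], of y] r(2)[OF y, of n] small
          by (simp add: dist_norm less_imp_le)
      qed simp
      moreover have "0 \<le> \<omega> n" by (rule order_trans[OF norm_ge_zero \<omega>_upper[of "1/2" n]]) simp
      ultimately show ?thesis using e by simp
    qed
    then show "\<exists>N. \<forall>n\<ge>N. dist (\<omega> n) 0 < e" by blast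
  qed
  define q where "q n y = s n y *\<^sub>R \<phi> (r n y)" for n y
  have fin: "emeasure ?M X \<noteq> \<infinity>" for X
  proof -
    have "emeasure ?M X \<le> emeasure ?M (space ?M)" by (rule emeasure_space)
    also have "\<dots> = 1" by (simp add: emeasure_restrict_space)
    finally show ?thesis by (auto simp: top_unique)
  qed
  have q: "Bochner_Integration.simple_bochner_integrable ?M (q n)" for n
  proof -
    define fl where "fl y = \<lfloor>real (Suc n) * y\<rfloor>" for y
    have "simple_function ?M fl"
      unfolding simple_function_eq_measurable
    proof
      have "fl ` space ?M \<subseteq> {0..int (Suc n)}"
      proof
        fix z assume "z \<in> fl ` space ?M"
        then obtain y where y: "0 < y" "y < 1" "z = \<lfloor>real (Suc n) * y\<rfloor>" by (auto simp: fl_def)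
        have "real (Suc n) * y < real_of_int (int (Suc n)) + 1"
        proof -
          have "real (Suc n) * y \<le> real (Suc n) * 1" using y by (intro mult_left_mono) auto
          then show ?thesis by (rule le_less_trans) simp
        qed
        then have "z \<le> int (Suc n)" unfolding y(3) floor_le_iff .
        then show "z \<in> {0..int (Suc n)}" using y by simp
      qed
      then show "finite (fl ` space ?M)" by (rule finite_subset) simp
      have "(\<lambda>y. real (Suc n) * y) \<in> borel_measurable ?M"
        by (intro measurable_Ioo01 continuous_intros)
      then show "fl \<in> measurable ?M (count_space UNIV)" unfolding fl_def by measurable
    qed
    \<comment> \<open>After rounding, \<open>\<phi>\<close> factors through the finitely many
      integers \<open>fl y\<close>, so it is simple whatever the target space.\<close>
    then have "simple_function ?M ((\<lambda>z. \<phi> (real_of_int z / real (Suc n))) \<circ> fl)"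
      by (rule simple_function_compose)
    then have "Bochner_Integration.simple_bochner_integrable ?M (\<lambda>y. \<phi> (r n y))"
      using fin by (auto intro!: simple_bochner_integrable.intros simp: comp_def fl_def r_def)
    then show ?thesis
      unfolding q_def by (intro simple_bochner_integrable_compose2[of scaleR] s) simp_all
  qed
  define b where "b n y = K * \<bar>\<kappa> y - s n y\<bar> + \<omega> n * \<bar>\<kappa> y\<bar>" for n y
  have b: "integrable ?M (b n)" "integral\<^sup>L ?M (b n) = K * a n + \<omega> n * A" for n
    unfolding b_def a_def A_def using \<kappa>(1) sint by auto
  have b0: "(\<lambda>n. K * a n + \<omega> n * A) \<longlonglongrightarrow> 0"
    using tendsto_add[OF tendsto_mult_right_zero[OF a] tendsto_mult_left_zero[OF \<omega>]] by simp
  have le: "norm (\<kappa> y *\<^sub>R \<phi> y - q n y) \<le> b n y" if y: "y \<in> {0<..<1}" for n y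
  proof -
    have "\<kappa> y *\<^sub>R \<phi> y - q n y = (\<kappa> y - s n y) *\<^sub>R \<phi> (r n y) + \<kappa> y *\<^sub>R (\<phi> y - \<phi> (r n y))"
      by (simp add: q_def algebra_simps)
    also have "norm \<dots> \<le> \<bar>\<kappa> y - s n y\<bar> * norm (\<phi> (r n y)) + \<bar>\<kappa> y\<bar> * norm (\<phi> y - \<phi> (r n y))"
      by (metis norm_scaleR norm_triangle_ineq)
    also have "\<dots> \<le> \<bar>\<kappa> y - s n y\<bar> * K + \<bar>\<kappa> y\<bar> * \<omega> n"
      by (intro add_mono mult_left_mono K r y \<omega>_upper) auto
    finally show ?thesis by (simp add: b_def mult.commute)
  qed
  show ?thesis
    unfolding has_bochner_def
  proof (intro conjI exI[of _ q] allI q)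
    show "(\<lambda>y. \<kappa> y *\<^sub>R \<phi> y) \<in> borel_measurable ?M"
      by (intro measurable_Ioo01 continuous_intros \<kappa> continuous_on_subset[OF \<phi>]) auto
    show "(\<lambda>n. \<integral>\<^sup>+y. ennreal (norm (\<kappa> y *\<^sub>R \<phi> y - q n y)) \<partial>?M) \<longlonglongrightarrow> 0"
    proof (rule tendsto_sandwich[where f="\<lambda>_. 0" and h="\<lambda>n. ennreal (K * a n + \<omega> n * A)"])
      have "(\<integral>\<^sup>+y. ennreal (norm (\<kappa> y *\<^sub>R \<phi> y - q n y)) \<partial>?M) \<le> ennreal (K * a n + \<omega> n * A)" for n
      proof -
        have "(\<integral>\<^sup>+y. ennreal (norm (\<kappa> y *\<^sub>R \<phi> y - q n y)) \<partial>?M) \<le> (\<integral>\<^sup>+y. ennreal (b n y) \<partial>?M)"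
          by (intro nn_integral_mono ennreal_leI le) simp
        also have "\<dots> = ennreal (integral\<^sup>L ?M (b n))"
          by (intro nn_integral_eq_integral b AE_I2) (auto intro: order_trans[OF norm_ge_zero le])
        finally show ?thesis by (simp add: b)
      qed
      then show "\<forall>\<^sub>F n in sequentially. (\<integral>\<^sup>+y. ennreal (norm (\<kappa> y *\<^sub>R \<phi> y - q n y)) \<partial>?M)
          \<le> ennreal (K * a n + \<omega> n * A)" by simp
      show "(\<lambda>n. ennreal (K * a n + \<omega> n * A)) \<longlonglongrightarrow> 0"
        using tendsto_ennrealI[OF b0] by simp
    qed auto
    have "dist (Bochner_Integration.simple_bochner_integral ?M (q n)) I \<le> K * a n + \<omega> n * A" for n
      using weak_integral_norm_le[OF weak_integral_diff[OF I simple_bochner_imp_weak_integral[OF q]] b(1)]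
        le b(2) by (simp add: dist_norm norm_minus_commute)
    then have "(\<lambda>n. dist (Bochner_Integration.simple_bochner_integral ?M (q n)) I) \<longlonglongrightarrow> 0"
      by (intro tendsto_sandwich[OF _ _ tendsto_const b0]) auto
    then show "(\<lambda>n. Bochner_Integration.simple_bochner_integral ?M (q n)) \<longlonglongrightarrow> I"
      unfolding tendsto_dist_iff[of _ I] .
  qed
qed

section \<open>The Erdelyi-Kober kernel\<close>

lemma continuous_on_dilation:
  fixes \<phi> :: "real \<Rightarrow> 'b::topological_space"
  assumes "continuous_on {0..} \<phi>" "0 < t"
  shows "continuous_on {0..1} (\<lambda>y. \<phi> (t * sqrt y))"
  by (rule continuous_on_compose2[OF assms(1)]) (use assms(2) in \<open>auto intro!: continuous_intros\<close>)

lemma weak_integral_Ioo01_exists: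
  fixes \<phi> :: "real \<Rightarrow> 'h::{real_inner, complete_space}"
  assumes \<kappa>: "integrable Ioo01 \<kappa>" "continuous_on {0<..<1} \<kappa>" and \<phi>: "continuous_on {0..1} \<phi>"
  obtains I where "weak_integral Ioo01 (\<lambda>y. \<kappa> y *\<^sub>R \<phi> y) I"
proof -
  have comp: "compact (\<phi> ` {0..1})" by (intro compact_continuous_image \<phi>) simp
  obtain K where K: "\<And>y. y \<in> {0..1} \<Longrightarrow> norm (\<phi> y) \<le> K"
    using compact_imp_bounded[OF comp] unfolding bounded_iff by (meson imageI)
  show thesis
  proof (rule weak_integral_exists[of Ioo01 "\<lambda>y. \<bar>\<kappa> y\<bar> * K"])
    show "norm (\<kappa> y *\<^sub>R \<phi> y) \<le> \<bar>\<kappa> y\<bar> * K" if "y \<in> space Ioo01" for y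
      using mult_left_mono[OF K, of y "\<bar>\<kappa> y\<bar>"] that by simp
    show "(\<lambda>y. (\<kappa> y *\<^sub>R \<phi> y) \<bullet> e) \<in> borel_measurable Ioo01" for e
      by (intro measurable_Ioo01 continuous_intros \<kappa> continuous_on_subset[OF \<phi>]) auto
  qed (use \<kappa> that in auto)
qed

text \<open>In the Hilbert space \<open>real\<close>, the test vector 1 turns a weak integral into
  an ordinary one.\<close>

lemma integrable_Ioo01_mult:
  fixes \<kappa> \<phi> :: "real \<Rightarrow> real"
  assumes "integrable Ioo01 \<kappa>" "continuous_on {0<..<1} \<kappa>" "continuous_on {0..1} \<phi>"
  shows "integrable Ioo01 (\<lambda>y. \<kappa> y * \<phi> y)"
proof -
  obtain I where "weak_integral Ioo01 (\<lambda>y. \<kappa> y *\<^sub>R \<phi> y) I"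
    by (rule weak_integral_Ioo01_exists[OF assms])
  then have "has_bochner_integral Ioo01 (\<lambda>y. (\<kappa> y *\<^sub>R \<phi> y) \<bullet> 1) (I \<bullet> 1)"
    unfolding weak_integral_def by blast
  then show ?thesis by (auto intro: integrable.intros)
qed

text \<open>Uniform continuity of \<open>\<phi>'\<close> on a compact interval bounds the
  linearization error of \<open>\<phi>\<close> at \<open>t * s\<close> by
  \<open>\<bar>r - t\<bar> * e'\<close> for all \<open>s\<close> in (0,1) at once, and
  \<open>weak_integral_norm_le\<close> passes this on to \<open>W\<close>. The chain rule puts the
  extra \<open>sqrt y\<close> into the kernel.\<close>

lemma weak_integral_dilation_has_derivative:
  fixes \<phi> \<phi>' W W' :: "real \<Rightarrow> 'h::real_inner"
  assumes \<kappa>: "integrable Ioo01 \<kappa>"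
    and \<phi>: "\<And>s. 0 < s \<Longrightarrow> (\<phi> has_vector_derivative \<phi>' s) (at s)"
    and \<phi>': "continuous_on {0..} \<phi>'"
    and W: "\<And>t. 0 < t \<Longrightarrow> weak_integral Ioo01 (\<lambda>y. \<kappa> y *\<^sub>R \<phi> (t * sqrt y)) (W t)"
    and W': "\<And>t. 0 < t \<Longrightarrow> weak_integral Ioo01 (\<lambda>y. (\<kappa> y * sqrt y) *\<^sub>R \<phi>' (t * sqrt y)) (W' t)"
    and t: "0 < t"
  shows "(W has_vector_derivative W' t) (at t)"
  unfolding has_vector_derivative_def has_derivative_at_alt
proof (intro conjI allI impI)
  show "bounded_linear (\<lambda>h. h *\<^sub>R W' t)" by (rule bounded_linear_scaleR_left)
  fix e :: real assume e: "0 < e"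
  define A where "A = (\<integral>y. \<bar>\<kappa> y\<bar> \<partial>Ioo01)"
  have A: "0 \<le> A" by (simp add: A_def)
  \<comment> \<open>\<open>A + 1\<close> instead of \<open>A\<close> avoids division by 0 for a
    vanishing kernel.\<close>
  define e' where "e' = e / (A + 1)"
  have e': "0 < e'" "A * e' \<le> e"
    using A e by (auto simp: e'_def field_simps)
  have "uniformly_continuous_on {0..t+1} \<phi>'"
    by (intro compact_uniformly_continuous continuous_on_subset[OF \<phi>']) auto
  then obtain d where d: "0 < d" and dd: "\<And>x y. x \<in> {0..t+1} \<Longrightarrow> y \<in> {0..t+1} \<Longrightarrow>
      dist y x < d \<Longrightarrow> dist (\<phi>' y) (\<phi>' x) < e'"
    unfolding uniformly_continuous_on_def using e' by metis
  show "\<exists>d>0. \<forall>r. norm (r - t) < d \<longrightarrow> norm (W r - W t - (r - t) *\<^sub>R W' t) \<le> e * norm (r - t)"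
  \<comment> \<open>\<open>d\<close> serves the modulus of continuity, \<open>t\<close> keeps
    \<open>r\<close> positive, and 1 keeps the arguments in the interval up to
    \<open>t + 1\<close>.\<close>
  proof (intro exI[of _ "min d (min t 1)"] conjI allI impI)
    fix r assume r: "norm (r - t) < min d (min t 1)"
    then have r0: "0 < r" and r1: "r < t + 1" and rd: "\<bar>r - t\<bar> < d" by auto
    have le: "norm (\<phi> (r * s) - \<phi> (t * s) - ((r - t) * s) *\<^sub>R \<phi>' (t * s)) \<le> \<bar>r - t\<bar> * e'"
      if s: "0 < s" "s < 1" for s
    proof -
      have in01: "0 < r * s" "r * s \<le> t + 1" "0 < t * s" "t * s \<le> t + 1" "\<bar>r * s - t * s\<bar> \<le> \<bar>r - t\<bar>"
      proof -
        have "r * s \<le> r * 1" "t * s \<le> t * 1" using s r0 t by (intro mult_left_mono; simp)+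
        then show "r * s \<le> t + 1" "t * s \<le> t + 1" using r1 by auto
        show "0 < r * s" "0 < t * s" using s r0 t by auto
        have "\<bar>r * s - t * s\<bar> = \<bar>r - t\<bar> * s" using s by (simp flip: left_diff_distrib add: abs_mult)
        also have "\<dots> \<le> \<bar>r - t\<bar> * 1" using s by (intro mult_left_mono) auto
        finally show "\<bar>r * s - t * s\<bar> \<le> \<bar>r - t\<bar>" by simp
      qed
      let ?S = "closed_segment (t * s) (r * s)"
      have S: "0 < x \<and> x \<le> t + 1 \<and> \<bar>x - t * s\<bar> \<le> \<bar>r * s - t * s\<bar>" if "x \<in> ?S" for x
        using that in01 by (auto simp: closed_segment_eq_real_ivl split: if_splits)
      have "norm (\<phi> (r * s) - \<phi> (t * s) - (r * s - t * s) *\<^sub>R \<phi>' (t * s)) \<le> norm (r * s - t * s) * e'"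
      proof (rule vector_differentiable_bound_linearization[of ?S])
        show "(\<phi> has_vector_derivative \<phi>' x) (at x within ?S)" if "x \<in> ?S" for x
          using \<phi>[of x] S[OF that] by (auto intro: has_vector_derivative_at_within)
        show "norm (\<phi>' x - \<phi>' (t * s)) \<le> e'" if "x \<in> ?S" for x
          using dd[of "t * s" x] S[OF that] in01 rd by (simp add: dist_norm less_imp_le)
      qed auto
      also have "\<dots> \<le> \<bar>r - t\<bar> * e'" using in01 e' by (intro mult_right_mono) auto
      finally show ?thesis by (simp add: left_diff_distrib)
    qed
    have "norm (W r - W t - (r - t) *\<^sub>R W' t) \<le> (\<integral>y. \<bar>\<kappa> y\<bar> * (\<bar>r - t\<bar> * e') \<partial>Ioo01)"
    proof (rule weak_integral_norm_le[OF weak_integral_diff[OF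
            weak_integral_diff[OF W[OF r0] W[OF t]] weak_integral_scaleR[OF W'[OF t]]]])
      fix y assume "y \<in> space Ioo01"
      then have s: "0 < sqrt y" "sqrt y < 1" by auto
      have "\<kappa> y *\<^sub>R \<phi> (r * sqrt y) - \<kappa> y *\<^sub>R \<phi> (t * sqrt y) -
          (r - t) *\<^sub>R (\<kappa> y * sqrt y) *\<^sub>R \<phi>' (t * sqrt y) =
        \<kappa> y *\<^sub>R (\<phi> (r * sqrt y) - \<phi> (t * sqrt y) - ((r - t) * sqrt y) *\<^sub>R \<phi>' (t * sqrt y))"
        by (simp add: scaleR_diff_right mult.commute mult.left_commute)
      also have "norm \<dots> \<le> \<bar>\<kappa> y\<bar> * (\<bar>r - t\<bar> * e')"
        using mult_left_mono[OF le[OF s], of "\<bar>\<kappa> y\<bar>"] by simp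
      finally show "norm (\<kappa> y *\<^sub>R \<phi> (r * sqrt y) - \<kappa> y *\<^sub>R \<phi> (t * sqrt y) -
          (r - t) *\<^sub>R (\<kappa> y * sqrt y) *\<^sub>R \<phi>' (t * sqrt y)) \<le> \<bar>\<kappa> y\<bar> * (\<bar>r - t\<bar> * e')" .
    qed (use \<kappa> in simp)
    also have "\<dots> = (A * e') * \<bar>r - t\<bar>" by (simp add: A_def)
    also have "\<dots> \<le> e * norm (r - t)" using e' by (simp add: mult_right_mono)
    finally show "norm (W r - W t - (r - t) *\<^sub>R W' t) \<le> e * norm (r - t)" .
  qed (use d t in auto)
qed

lemma weak_integral_const:
  assumes "has_bochner_integral M \<kappa> b"
  shows "weak_integral M (\<lambda>x. \<kappa> x *\<^sub>R c) (b *\<^sub>R c)"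
  using assms by (simp add: weak_integral_def has_bochner_integral_mult_left)

text \<open>For small \<open>t\<close> the dilated path stays close to \<open>\<phi> 0\<close>,
  uniformly in \<open>y\<close>, so only the total mass \<open>b\<close> of the kernel
  survives.\<close>

lemma weak_integral_dilation_tendsto:
  fixes \<phi> W :: "real \<Rightarrow> 'h::real_inner"
  assumes \<kappa>: "has_bochner_integral Ioo01 \<kappa> b" and \<phi>: "continuous_on {0..} \<phi>"
    and W: "\<And>t. 0 < t \<Longrightarrow> weak_integral Ioo01 (\<lambda>y. \<kappa> y *\<^sub>R \<phi> (t * sqrt y)) (W t)"
  shows "(W \<longlongrightarrow> b *\<^sub>R \<phi> 0) (at_right 0)"
proof (rule tendstoI)
  fix e :: real assume e: "0 < e"
  have int: "integrable Ioo01 \<kappa>" using \<kappa> by (rule integrable.intros)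
  define A where "A = (\<integral>y. \<bar>\<kappa> y\<bar> \<partial>Ioo01)"
  have A: "0 \<le> A" by (simp add: A_def)
  define e' where "e' = e / (A + 1)"
  have e': "0 < e'" "A * e' < e"
    using A e by (auto simp: e'_def field_simps)
  have "\<exists>d>0. \<forall>s\<in>{0..}. dist s 0 < d \<longrightarrow> dist (\<phi> s) (\<phi> 0) < e'"
    using \<phi>[unfolded continuous_on_iff] e'(1) by (meson atLeast_iff order_refl)
  then obtain d where d: "0 < d" and dd: "\<And>s. 0 \<le> s \<Longrightarrow> s < d \<Longrightarrow> dist (\<phi> s) (\<phi> 0) < e'"
    by auto
  show "\<forall>\<^sub>F t in at_right 0. dist (W t) (b *\<^sub>R \<phi> 0) < e"
    using eventually_at_right_real[OF d]
  proof eventually_elim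
    fix t assume t: "t \<in> {0<..<d}"
    have "norm (W t - b *\<^sub>R \<phi> 0) \<le> (\<integral>y. \<bar>\<kappa> y\<bar> * e' \<partial>Ioo01)"
    proof (rule weak_integral_norm_le[OF weak_integral_diff[OF W weak_integral_const[OF \<kappa>]]])
      fix y assume "y \<in> space Ioo01"
      then have "0 \<le> t * sqrt y" "t * sqrt y \<le> t * 1"
        using t by (auto intro!: mult_left_mono simp del: mult_1_right)
      moreover have "t * 1 < d" using t by simp
      ultimately have "dist (\<phi> (t * sqrt y)) (\<phi> 0) < e'" by (intro dd) linarith+
      then have "norm (\<phi> (t * sqrt y) - \<phi> 0) \<le> e'" by (simp add: dist_norm)
      then show "norm (\<kappa> y *\<^sub>R \<phi> (t * sqrt y) - \<kappa> y *\<^sub>R \<phi> 0) \<le> \<bar>\<kappa> y\<bar> * e'"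
        by (simp add: mult_left_mono flip: scaleR_diff_right)
    qed (use t int in auto)
    also have "\<dots> = A * e'" by (simp add: A_def)
    finally show "dist (W t) (b *\<^sub>R \<phi> 0) < e" using e' by (simp add: dist_norm)
  qed
qed

section \<open>The kernel itself: Beta integral and integration by parts\<close>

text \<open>The weight \<open>(1 - y) powr (lam - 1)\<close> of the fractional integral at 1, merged
  with the factor \<open>1 / sqrt y\<close> of the function integrated; up to normalization the
  Beta(1/2, lam) density.\<close>

definition EK_kernel :: "real \<Rightarrow> real \<Rightarrow> real" where
  "EK_kernel lam y = (1 - y) powr (lam - 1) / sqrt y"

lemma EK_kernel_continuous: "continuous_on {0<..<1} (EK_kernel lam)"
  unfolding EK_kernel_def by (intro continuous_intros) auto

lemma EK_kernel_has_integral: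
  assumes lam: "0 < lam"
  shows "has_bochner_integral Ioo01 (EK_kernel lam) (Beta (1/2) lam)"
proof -
  have eq: "y powr (1/2 - 1) * (1 - y) powr (lam - 1) = EK_kernel lam y" if "y \<in> {0<..<1}" for y :: real
  proof -
    have "y powr (1/2 - 1) = y powr (- (1/2))" by simp
    also have "\<dots> = 1 / sqrt y" using that by (simp only: powr_minus powr_half_sqrt) (simp add: powr_half_sqrt inverse_eq_divide)
    finally show ?thesis by (simp add: EK_kernel_def)
  qed
  have "((\<lambda>y. y powr (1/2 - 1) * (1 - y) powr (lam - 1)) has_integral Beta (1/2) lam) {0<..<1}"
    using has_integral_Beta_real[of "1/2" lam] lam by (simp add: has_integral_Icc_iff_Ioo)
  then have hi: "(EK_kernel lam has_integral Beta (1/2) lam) {0<..<1}"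
    by (subst (asm) has_integral_cong[OF eq]) auto
  then have "EK_kernel lam absolutely_integrable_on {0<..<1}"
    by (intro nonnegative_absolutely_integrable_1) (auto simp: EK_kernel_def integrable_on_def)
  then have int: "integrable Ioo01 (EK_kernel lam)"
    by (rule absolutely_integrable_imp_integrable) auto
  then show ?thesis
    using lebesgue_integral_eq_integral[OF int] integral_unique[OF hi]
    by (simp add: has_bochner_integral_iff)
qed

text \<open>The integrand is the derivative of \<open>- (2/t) (1 - y)\<^sup>\<lambda> p (t \<surd>y)\<close>, which vanishes at both ends.\<close>
lemma EK_kernel_integration_by_parts:
  fixes p q :: "real \<Rightarrow> real"
  assumes lam: "0 < lam" and t: "0 < t" and p: "continuous_on {0..} p" "p 0 = 0"
    and q: "continuous_on {0..} q" and pq: "\<And>s. 0 < s \<Longrightarrow> (p has_real_derivative q s) (at s)"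
  shows "has_bochner_integral Ioo01
    (\<lambda>y. EK_kernel lam y * ((y - 1) * q (t * sqrt y) + (2 * lam / t) * sqrt y * p (t * sqrt y))) 0"
    (is "has_bochner_integral _ ?g 0")
proof -
  have int: "integrable Ioo01 ?g"
    by (intro integrable_Ioo01_mult EK_kernel_continuous integrable.intros[OF EK_kernel_has_integral]
        continuous_intros continuous_on_dilation lam p q t)
  define F where "F y = - (2 / t) * (1 - y) powr lam * p (t * sqrt y)" for y
  have "(?g has_integral F 1 - F 0) {0..1}"
  \<comment> \<open>Only continuity is available at the ends: \<open>sqrt\<close> is not
    differentiable at 0, nor \<open>(1 - y) powr lam\<close> at 1 when
    \<open>lam < 1\<close>.\<close>
  proof (rule fundamental_theorem_of_calculus_interior)
    show "continuous_on {0..1} F"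
      unfolding F_def
      by (intro continuous_intros continuous_on_powr' continuous_on_dilation p t) (use lam in auto)
    fix y :: real assume "y \<in> {0<..<1}"
    then have y: "0 < y" "y < 1" by auto
    have dp: "((\<lambda>y. p (t * sqrt y)) has_real_derivative q (t * sqrt y) * (t * (inverse (sqrt y) / 2))) (at y)"
      by (rule DERIV_chain2[OF pq]) (use y t in \<open>auto intro!: derivative_eq_intros\<close>)
    have dw: "((\<lambda>y. (1 - y) powr lam) has_real_derivative - (lam * (1 - y) powr (lam - 1))) (at y)"
      using y by (auto intro!: derivative_eq_intros simp: powr_diff)
    have "(F has_real_derivative
        (2 / t) * (lam * (1 - y) powr (lam - 1)) * p (t * sqrt y)
        - (2 / t) * (1 - y) powr lam * (q (t * sqrt y) * (t * (inverse (sqrt y) / 2)))) (at y)"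
      unfolding F_def mult.assoc
      by (rule DERIV_cong[OF DERIV_cmult[OF DERIV_mult[OF dw dp]]]) (simp add: algebra_simps)
    also have "(2 / t) * (lam * (1 - y) powr (lam - 1)) * p (t * sqrt y)
        - (2 / t) * (1 - y) powr lam * (q (t * sqrt y) * (t * (inverse (sqrt y) / 2))) = ?g y"
    proof -
      have pl: "(1 - y) powr lam = (1 - y) * (1 - y) powr (lam - 1)"
        using y by (simp add: powr_diff)
      show ?thesis
        unfolding pl EK_kernel_def using y t by (simp add: field_simps)
    qed
    finally show "(F has_vector_derivative ?g y) (at y)"
      by (simp add: has_real_derivative_iff_has_vector_derivative)
  qed simp
  also have "F 1 - F 0 = 0" using lam p(2) by (simp add: F_def)
  finally have "integral {0<..<1} ?g = 0" by (simp add: has_integral_Icc_iff_Ioo integral_unique)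
  then show ?thesis
    using lebesgue_integral_eq_integral[OF int] int by (simp add: has_bochner_integral_iff)
qed

section \<open>Classical solutions\<close>

lemma continuous_on_nonneg_if_differentiable:
  assumes "\<And>s. 0 \<le> s \<Longrightarrow> (v has_vector_derivative v' s) (at s within {0..})"
  shows "continuous_on {0..} v"
  unfolding continuous_on_eq_continuous_within
  using assms has_vector_derivative_continuous by fastforce

text \<open>\<open>C u\<close> is continuous up to 0, hence bounded there, and it is minus the
  radial operator applied to \<open>B u\<close>, so \<open>radial_derivative_bound\<close> applies.
  The scalar equation is covered too, with the identity for \<open>B\<close> and a multiple of it
  for \<open>C\<close>.\<close>

lemma resolvent_velocity_tendsto_0:
  fixes u u1 u2 :: "real \<Rightarrow> 'h::real_inner" and B C :: "'h \<Rightarrow> 'h"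
  assumes u: "\<And>s. 0 \<le> s \<Longrightarrow> (u has_vector_derivative u1 s) (at s within {0..})"
    and u1: "\<And>s. 0 < s \<Longrightarrow> (u1 has_vector_derivative u2 s) (at s)"
    and eq: "\<And>s. 0 < s \<Longrightarrow> B (u2 s) + (2 * lam / s) *\<^sub>R B (u1 s) + C (u s) = 0"
    and u10: "u1 0 = 0" and lam: "0 \<le> lam"
    and B: "bounded_linear B" and C: "bounded_linear C"
  shows "((\<lambda>t. B (u1 t)) \<longlongrightarrow> 0) (at_right 0)"
proof -
  have contC: "continuous_on {0..1} (\<lambda>s. C (u s))"
    by (intro bounded_linear.continuous_on[OF C]
        continuous_on_subset[OF continuous_on_nonneg_if_differentiable[OF u]]) auto
  have comp: "compact ((\<lambda>s. C (u s)) ` {0..1})" by (intro compact_continuous_image contC) simp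
  obtain K where K: "\<And>s. s \<in> {0..1} \<Longrightarrow> norm (C (u s)) \<le> K"
    using compact_imp_bounded[OF comp] unfolding bounded_iff by (meson imageI)
  have K0: "0 \<le> K" by (rule order_trans[OF norm_ge_zero K[of 0]]) simp
  have bound: "norm (B (u1 t)) \<le> K * t" if t: "0 < t" "t < 1" for t
  proof (rule radial_derivative_bound[of "\<lambda>s. B (u s)" "\<lambda>s. B (u1 s)" "\<lambda>s. B (u2 s)"])
    show "((\<lambda>s. B (u s)) has_vector_derivative B (u1 s)) (at s within {0..})" if "0 \<le> s" for s
      by (rule bounded_linear.has_vector_derivative[OF B u[OF that]])
    show "((\<lambda>s. B (u1 s)) has_vector_derivative B (u2 s)) (at s)" if "0 < s" for s
      by (rule bounded_linear.has_vector_derivative[OF B u1[OF that]])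
    show "norm (B (u2 s) + (2 * lam / s) *\<^sub>R B (u1 s)) \<le> K" if s: "0 < s" "s \<le> t" for s
    proof -
      have "B (u2 s) + (2 * lam / s) *\<^sub>R B (u1 s) = - C (u s)"
        using eq[OF s(1)] by (simp add: eq_neg_iff_add_eq_0)
      then show ?thesis using K[of s] s t by simp
    qed
  qed (use u10 lam t K0 linear_0[OF bounded_linear.linear[OF B]] in auto)
  show ?thesis
  proof (rule Lim_null_comparison)
    show "\<forall>\<^sub>F t in at_right 0. norm (B (u1 t)) \<le> K * t"
      using eventually_at_right_real[of 0 1] by (auto elim!: eventually_mono intro: bound)
    show "((\<lambda>t. K * t) \<longlongrightarrow> 0) (at_right 0)"
      by (intro tendsto_mult_right_zero) (rule tendsto_ident_at)
  qed
qed

text \<open>The factor Beta(1/2, lam) is the mass of the kernel: both sides tend to Beta(1/2, lam)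
  times \<open>f\<close> as \<open>T\<close> tends to 0.\<close>

lemma EPD_solution_eq_EK_wave:
  fixes u ub :: "real \<Rightarrow> 'h::{real_inner, complete_space}"
  assumes lam: "0 < lam" and sa: "selfadjoint D A" and pos: "positive_operator D A"
    and "solves_EPD lam D A f u" and "solves_wave D A f ub" and T: "0 < T"
  shows "weak_integral Ioo01 (\<lambda>y. EK_kernel lam y *\<^sub>R ub (T * sqrt y)) (Beta (1/2) lam *\<^sub>R u T)"
proof -
  define b where "b = Beta (1/2) lam"
  obtain B where B: "bounded_linear B" and symB: "\<And>x y. B x \<bullet> y = x \<bullet> B y"
    and Bpos: "\<And>x. x \<noteq> 0 \<Longrightarrow> 0 < B x \<bullet> x" and Ble: "\<And>x. B x \<bullet> x \<le> x \<bullet> x"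
    and BA: "\<And>x. x \<in> D \<Longrightarrow> B (A x) = x - B x"
    by (rule positive_selfadjoint_resolvent[OF sa pos]) (rule that; assumption)
  interpret B: bounded_linear B by (rule B)
  define C where "C x = x - B x" for x
  have C: "bounded_linear C" unfolding C_def by (intro bounded_linear_sub bounded_linear_ident B)
  interpret C: bounded_linear C by (rule C)
  have symC: "C x \<bullet> y = x \<bullet> C y" for x y by (simp add: C_def inner_diff_left inner_diff_right symB)
  have Cpos: "0 \<le> C x \<bullet> x" for x using Ble by (simp add: C_def inner_diff_left)
  have BC: "B (C x) = C (B x)" for x by (simp add: C_def B.diff)
  have B_nonneg: "0 \<le> B x \<bullet> x" for x using Bpos[of x] by (cases "x = 0") (auto simp: B.zero)
  \<comment> \<open>Definiteness serves twice: on the energy, and at the end as injectivity of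
    \<open>B\<close>.\<close>
  have B0: "x = 0" if "B x \<bullet> x \<le> 0" for x using Bpos[of x] that by force
  obtain u1 u2 where
    u: "\<And>s. 0 \<le> s \<Longrightarrow> (u has_vector_derivative u1 s) (at s within {0..})"
    and u1: "\<And>s. 0 < s \<Longrightarrow> (u1 has_vector_derivative u2 s) (at s)"
    and ueq: "\<And>s. 0 < s \<Longrightarrow> u s \<in> D \<and> u2 s + (2 * lam / s) *\<^sub>R u1 s + A (u s) = 0"
    and u0: "u 0 = f" "u1 0 = 0"
    using assms(4) unfolding solves_EPD_def by metis
  obtain w1 w2 where
    w: "\<And>s. 0 \<le> s \<Longrightarrow> (ub has_vector_derivative w1 s) (at s within {0..})"
    and w1: "\<And>s. 0 < s \<Longrightarrow> (w1 has_vector_derivative w2 s) (at s)"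
    and weq: "\<And>s. 0 < s \<Longrightarrow> ub s \<in> D \<and> w2 s + A (ub s) = 0"
    and w0: "ub 0 = f" "w1 0 = 0"
    using assms(5) unfolding solves_wave_def by metis
  have Bu: "B (u2 s) + (2 * lam / s) *\<^sub>R B (u1 s) + C (u s) = 0" if "0 < s" for s
    using arg_cong[OF conjunct2[OF ueq[OF that]], of B] BA[OF conjunct1[OF ueq[OF that]]]
    by (simp only: B.add B.scaleR B.zero C_def)
  have Bw: "B (w2 s) = - C (ub s)" if "0 < s" for s
    using arg_cong[OF conjunct2[OF weq[OF that]], of B] BA[OF conjunct1[OF weq[OF that]]]
    by (simp only: B.add B.zero C_def eq_neg_iff_add_eq_0)
  have contu: "continuous_on {0..} u" and contw: "continuous_on {0..} ub"
    by (rule continuous_on_nonneg_if_differentiable[OF u] continuous_on_nonneg_if_differentiable[OF w],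
        assumption)+
  have tends0: "(h \<longlongrightarrow> h 0) (at_right 0)" if "continuous_on {0..} h" for h :: "real \<Rightarrow> 'h"
    using that unfolding continuous_on_def by (force intro: tendsto_within_subset)
  have Bu10: "((\<lambda>t. B (u1 t)) \<longlongrightarrow> 0) (at_right 0)"
    using lam by (intro resolvent_velocity_tendsto_0[OF u u1 Bu u0(2) _ B C]) auto
  \<comment> \<open>The wave equation is the radial one with \<open>lam = 0\<close>.\<close>
  have Bw10: "((\<lambda>t. B (w1 t)) \<longlongrightarrow> 0) (at_right 0)"
    by (intro resolvent_velocity_tendsto_0[OF w w1 _ w0(2) _ B C, where lam=0]) (auto simp: Bw)
  define V where "V = (\<lambda>s. B (ub s))"
  define V1 where "V1 = (\<lambda>s. B (w1 s))"
  define V2 where "V2 = (\<lambda>s. - C (ub s))"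
  have V: "(V has_vector_derivative V1 s) (at s)" if "0 < s" for s
    using B.has_vector_derivative[OF w, of s] that at_within_nonneg[OF that] by (simp add: V_def V1_def)
  have V1: "(V1 has_vector_derivative V2 s) (at s)" if "0 < s" for s
    using B.has_vector_derivative[OF w1[OF that]] by (simp add: V1_def V2_def Bw that)
  have contV: "continuous_on {0..} V" unfolding V_def by (rule B.continuous_on[OF contw])
  have contV2: "continuous_on {0..} V2"
    unfolding V2_def by (intro continuous_intros C.continuous_on contw)
  \<comment> \<open>The problem gives no continuity of \<open>w1\<close> at 0; for
    \<open>V1\<close>, the image of \<open>w1\<close> under \<open>B\<close>, it is
    \<open>Bw10\<close>.\<close>
  have contV1: "continuous_on {0..} V1"
    unfolding continuous_on_def
  proof
    fix s :: real assume s: "s \<in> {0..}"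
    show "(V1 \<longlongrightarrow> V1 s) (at s within {0..})"
    proof (cases "s = 0")
      case True
      then show ?thesis using Bw10 w0 by (simp add: V1_def B.zero at_within_Ici_at_right)
    next
      case False
      then have "isCont V1 s" using s by (intro has_vector_derivative_continuous[OF V1]) auto
      then show ?thesis unfolding isCont_def by (rule tendsto_within_subset) simp
    qed
  qed
  let ?k = "EK_kernel lam"
  have k: "has_bochner_integral Ioo01 ?k b" unfolding b_def by (rule EK_kernel_has_integral[OF lam])
  have intk: "integrable Ioo01 ?k" using k by (rule integrable.intros)
  have intks: "integrable Ioo01 (\<lambda>y. ?k y * sqrt y)"
    by (intro integrable_Ioo01_mult intk EK_kernel_continuous continuous_intros)
  have contks: "continuous_on {0<..<1} (\<lambda>y. ?k y * sqrt y)"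
    by (intro continuous_intros EK_kernel_continuous)
  have intkss: "integrable Ioo01 (\<lambda>y. ?k y * sqrt y * sqrt y)"
    by (intro integrable_Ioo01_mult intks contks continuous_intros)
  have contkss: "continuous_on {0<..<1} (\<lambda>y. ?k y * sqrt y * sqrt y)"
    by (intro continuous_intros contks)
  have "\<exists>I. 0 < t \<longrightarrow> weak_integral Ioo01 (\<lambda>y. ?k y *\<^sub>R ub (t * sqrt y)) I" for t
    by (metis weak_integral_Ioo01_exists[OF intk EK_kernel_continuous continuous_on_dilation[OF contw]])
  then obtain Z where Z: "\<And>t. 0 < t \<Longrightarrow> weak_integral Ioo01 (\<lambda>y. ?k y *\<^sub>R ub (t * sqrt y)) (Z t)"
    by metis
  have "\<exists>I. 0 < t \<longrightarrow> weak_integral Ioo01 (\<lambda>y. (?k y * sqrt y) *\<^sub>R V1 (t * sqrt y)) I" for t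
    by (metis weak_integral_Ioo01_exists[OF intks contks continuous_on_dilation[OF contV1]])
  then obtain W1 where W1: "\<And>t. 0 < t \<Longrightarrow>
      weak_integral Ioo01 (\<lambda>y. (?k y * sqrt y) *\<^sub>R V1 (t * sqrt y)) (W1 t)"
    by metis
  have "\<exists>I. 0 < t \<longrightarrow> weak_integral Ioo01 (\<lambda>y. (?k y * sqrt y * sqrt y) *\<^sub>R V2 (t * sqrt y)) I" for t
    by (metis weak_integral_Ioo01_exists[OF intkss contkss continuous_on_dilation[OF contV2]])
  then obtain W2 where W2: "\<And>t. 0 < t \<Longrightarrow>
      weak_integral Ioo01 (\<lambda>y. (?k y * sqrt y * sqrt y) *\<^sub>R V2 (t * sqrt y)) (W2 t)"
    by metis
  define W where "W = (\<lambda>t. B (Z t))"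
  have W: "weak_integral Ioo01 (\<lambda>y. ?k y *\<^sub>R V (t * sqrt y)) (W t)" if "0 < t" for t
    using weak_integral_symmetric[OF Z[OF that] symB] by (simp add: W_def V_def B.scaleR)
  have dW: "(W has_vector_derivative W1 t) (at t)" if "0 < t" for t
    by (rule weak_integral_dilation_has_derivative[OF intk V contV1 W W1 that])
  have dW1: "(W1 has_vector_derivative W2 t) (at t)" if "0 < t" for t
    by (rule weak_integral_dilation_has_derivative[OF intks V1 contV2 W1 W2 that])
  \<comment> \<open>\<open>C (Z t)\<close> is the integral of the kernel times \<open>- V2\<close>,
    so together with \<open>W2 t\<close> it carries the factor \<open>y - 1\<close>. Tested against
    \<open>e\<close>, the whole sum is the integral of
    \<open>EK_kernel_integration_by_parts\<close>, with \<open>V1\<close> giving \<open>p\<close>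
    and \<open>V2\<close> giving \<open>q\<close>.\<close>
  have W_EPD: "W2 t + (2 * lam / t) *\<^sub>R W1 t + C (Z t) = 0" if t: "0 < t" for t
  proof -
    have C_Z: "weak_integral Ioo01 (\<lambda>y. C (?k y *\<^sub>R ub (t * sqrt y))) (C (Z t))"
      by (rule weak_integral_symmetric[OF Z[OF t] symC])
    have sum: "W2 t + (2 * lam / t) *\<^sub>R W1 t + C (Z t) = W2 t - (- (2 * lam / t)) *\<^sub>R W1 t - (-1) *\<^sub>R C (Z t)"
      by simp
    note all = weak_integral_diff[OF weak_integral_diff[OF W2[OF t]
          weak_integral_scaleR[OF W1[OF t], of "- (2 * lam / t)"]] weak_integral_scaleR[OF C_Z, of "-1"]]
    have zero: "weak_integral Ioo01 (\<lambda>y. (?k y * sqrt y * sqrt y) *\<^sub>R V2 (t * sqrt y)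
        - (- (2 * lam / t)) *\<^sub>R (?k y * sqrt y) *\<^sub>R V1 (t * sqrt y)
        - (-1) *\<^sub>R C (?k y *\<^sub>R ub (t * sqrt y))) 0"
      unfolding weak_integral_def
    proof
      fix e :: 'h
      have "has_bochner_integral Ioo01 (\<lambda>y. ?k y * ((y - 1) * (V2 (t * sqrt y) \<bullet> e)
          + (2 * lam / t) * sqrt y * (V1 (t * sqrt y) \<bullet> e))) 0"
      proof (rule EK_kernel_integration_by_parts[OF lam t, of "\<lambda>s. V1 s \<bullet> e" "\<lambda>s. V2 s \<bullet> e"])
        show "((\<lambda>s. V1 s \<bullet> e) has_real_derivative V2 s \<bullet> e) (at s)" if "0 < s" for s
          using has_derivative_inner_left[OF V1[OF that, unfolded has_vector_derivative_def], of e]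
          unfolding has_field_derivative_def
          by (rule has_derivative_eq_rhs) (simp add: fun_eq_iff mult.commute)
      qed (use contV1 contV2 w0 in \<open>auto intro!: continuous_intros simp: V1_def B.zero\<close>)
      moreover have "?k y * ((y - 1) * (V2 (t * sqrt y) \<bullet> e)
          + (2 * lam / t) * sqrt y * (V1 (t * sqrt y) \<bullet> e))
        = ((?k y * sqrt y * sqrt y) *\<^sub>R V2 (t * sqrt y)
        - (- (2 * lam / t)) *\<^sub>R (?k y * sqrt y) *\<^sub>R V1 (t * sqrt y)
        - (-1) *\<^sub>R C (?k y *\<^sub>R ub (t * sqrt y))) \<bullet> e" if "y \<in> space Ioo01" for y
      proof -
        have "?k y * sqrt y * sqrt y = ?k y * y" using that by (simp add: mult.assoc)
        then show ?thesis
          using that by (simp add: V2_def C.scaleR inner_diff_left inner_add_left algebra_simps)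
      qed
      ultimately show "has_bochner_integral Ioo01 (\<lambda>y. ((?k y * sqrt y * sqrt y) *\<^sub>R V2 (t * sqrt y)
        - (- (2 * lam / t)) *\<^sub>R (?k y * sqrt y) *\<^sub>R V1 (t * sqrt y)
        - (-1) *\<^sub>R C (?k y *\<^sub>R ub (t * sqrt y))) \<bullet> e) (0 \<bullet> e)"
        by (subst has_bochner_integral_cong[OF refl, symmetric]) auto
    qed
    show ?thesis unfolding sum by (rule weak_integral_unique[OF all zero])
  qed
  \<comment> \<open>This is \<open>B\<close> applied to \<open>b u - Z\<close>. Since
    \<open>Z\<close> itself is not known to be differentiable, the derivatives go through
    \<open>W\<close>.\<close>
  define v where "v = (\<lambda>t. b *\<^sub>R B (u t) - W t)"
  define v1 where "v1 = (\<lambda>t. b *\<^sub>R B (u1 t) - W1 t)"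
  define v2 where "v2 = (\<lambda>t. b *\<^sub>R B (u2 t) - W2 t)"
  have dv: "(v has_vector_derivative v1 t) (at t)" if "0 < t" for t
    unfolding v_def v1_def
    using B.has_vector_derivative[OF u, of t] at_within_nonneg[OF that] that
    by (auto intro!: derivative_eq_intros dW)
  have dv1: "(v1 has_vector_derivative v2 t) (at t)" if "0 < t" for t
    unfolding v1_def v2_def
    using B.has_vector_derivative[OF u1[OF that]] that
    by (auto intro!: derivative_eq_intros dW1)
  have v_eq: "B (v2 t) + (2 * lam / t) *\<^sub>R B (v1 t) + C (v t) = 0" if t: "0 < t" for t
  proof -
    have "v2 t + (2 * lam / t) *\<^sub>R v1 t =
        b *\<^sub>R (B (u2 t) + (2 * lam / t) *\<^sub>R B (u1 t)) - (W2 t + (2 * lam / t) *\<^sub>R W1 t)"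
      by (simp add: v1_def v2_def algebra_simps)
    also have "\<dots> = - (b *\<^sub>R C (u t) - C (Z t))"
      using Bu[OF t] W_EPD[OF t] by (simp add: add_eq_0_iff2)
    finally have "B (v2 t + (2 * lam / t) *\<^sub>R v1 t) = - C (v t)"
      by (simp add: v_def W_def B.diff B.neg B.scaleR C.diff C.scaleR BC)
    then show ?thesis by (simp add: B.add B.scaleR)
  qed
  have v_lim: "(v \<longlongrightarrow> 0) (at_right 0)"
  proof -
    have "(v \<longlongrightarrow> b *\<^sub>R B (u 0) - b *\<^sub>R V 0) (at_right 0)"
      unfolding v_def
      by (intro tendsto_intros B.tendsto tends0 contu weak_integral_dilation_tendsto[OF k contV W])
    then show ?thesis by (simp add: V_def u0 w0)
  qed
  have v1_lim: "(v1 \<longlongrightarrow> 0) (at_right 0)"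
  proof -
    \<comment> \<open>The value of the mass \<open>b'\<close> does not matter, as it multiplies
      \<open>V1 0 = 0\<close>.\<close>
    obtain b' where "has_bochner_integral Ioo01 (\<lambda>y. ?k y * sqrt y) b'"
      using intks by (auto elim: integrable.cases)
    from weak_integral_dilation_tendsto[OF this contV1 W1]
    have "(v1 \<longlongrightarrow> b *\<^sub>R 0 - b' *\<^sub>R V1 0) (at_right 0)"
      unfolding v1_def by (intro tendsto_intros Bu10)
    then show ?thesis by (simp add: V1_def w0 B.zero)
  qed
  \<comment> \<open>The initial energy is 0 and the \<open>C\<close> part is nonnegative, so
    \<open>B (v1 t) \<bullet> v1 t\<close> cannot be positive.\<close>
  have v1_0: "v1 t = 0" if "0 < t" for t
  proof -
    have "B (v1 t) \<bullet> v1 t + C (v t) \<bullet> v t \<le> C 0 \<bullet> 0"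
      by (rule EPD_energy_le[OF dv dv1 v_eq B symB _ C symC v_lim v1_lim _ that])
        (use lam B_nonneg in auto)
    then show ?thesis using Cpos[of "v t"] by (intro B0) simp
  qed
  \<comment> \<open>A vanishing derivative makes \<open>v\<close> constant, hence equal to its limit
    0 at the origin.\<close>
  have "v T = v s" if s: "0 < s" for s
  proof -
    have "\<exists>c. \<forall>x\<in>{0<..}. v x = c"
    proof (rule has_derivative_zero_constant)
      show "(v has_derivative (\<lambda>h. 0)) (at x within {0<..})" if "x \<in> {0<..}" for x
        using dv[of x] v1_0[of x] that
        by (auto simp: has_vector_derivative_def intro: has_derivative_at_withinI)
    qed simp
    then show ?thesis using s T by auto
  qed
  then have "\<forall>\<^sub>F s in at_right 0. v s = v T"
    by (auto simp: eventually_at_right_less eventually_at_filter)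
  then have "(v \<longlongrightarrow> v T) (at_right 0)" by (rule tendsto_eventually)
  from tendsto_unique[OF _ this v_lim] have "v T = 0" by simp
  then have "B (b *\<^sub>R u T - Z T) = 0" by (simp add: v_def W_def B.diff B.scaleR)
  then have "b *\<^sub>R u T - Z T = 0" by (intro B0) simp
  then show ?thesis using Z[OF T] by (simp add: b_def)
qed

section \<open>Solutions in the spectral representation\<close>

text \<open>The energy bounds \<open>z\<close> and \<open>z1\<close>. In \<open>z2\<close> the
  singular coefficient \<open>2 * lam / t\<close> is compensated by
  \<open>norm (z1 t) \<le> c * norm a * t\<close> from \<open>radial_derivative_bound\<close>. All
  bounds are independent of \<open>t\<close>, as domination requires.\<close>

lemma scalar_EPD_bounds:
  fixes z z1 z2 :: "real \<Rightarrow> 'k::real_inner"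
  assumes z: "\<And>s. 0 \<le> s \<Longrightarrow> (z has_vector_derivative z1 s) (at s within {0..})"
    and z1: "\<And>s. 0 < s \<Longrightarrow> (z1 has_vector_derivative z2 s) (at s)"
    and eq: "\<And>s. 0 < s \<Longrightarrow> z2 s + (2 * lam / s) *\<^sub>R z1 s + c *\<^sub>R z s = 0"
    and init: "z 0 = a" "z1 0 = 0" and lam: "0 \<le> lam" and c: "0 < c" and t: "0 < t"
  shows "norm (z t) \<le> norm a" "norm (z1 t) \<le> (1 + c) * norm a" "norm (z2 t) \<le> (1 + 2 * lam) * (c * norm a)"
proof -
  have id: "bounded_linear (\<lambda>x::'k. x)" and sc: "bounded_linear ((*\<^sub>R) c :: 'k \<Rightarrow> 'k)"
    by (rule bounded_linear_ident, rule bounded_linear_scaleR_right)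
  have z1_lim: "(z1 \<longlongrightarrow> 0) (at_right 0)"
    using resolvent_velocity_tendsto_0[OF z z1 eq init(2) lam id sc] .
  have z_lim: "(z \<longlongrightarrow> a) (at_right 0)"
    using continuous_on_nonneg_if_differentiable[OF z] init(1)
    unfolding continuous_on_def by (force intro: tendsto_within_subset)
  have z_at: "(z has_vector_derivative z1 s) (at s)" if "0 < s" for s
    using z[of s] at_within_nonneg[OF that] that by simp
  have energy: "(norm (z1 s))\<^sup>2 + c * (norm (z s))\<^sup>2 \<le> c * (norm a)\<^sup>2" if s: "0 < s" for s
    using EPD_energy_le[OF z_at z1 eq id _ _ sc _ z_lim z1_lim lam s]
    by (simp add: power2_norm_eq_inner)
  have z_le: "norm (z s) \<le> norm a" if s: "0 < s" for s
  proof -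
    have "c * (norm (z s))\<^sup>2 \<le> c * (norm a)\<^sup>2" using energy[OF s] by (smt (verit) zero_le_power2)
    then have "(norm (z s))\<^sup>2 \<le> (norm a)\<^sup>2" using c by simp
    then show ?thesis by (rule power2_le_imp_le) simp
  qed
  then show "norm (z t) \<le> norm a" using t .
  show "norm (z1 t) \<le> (1 + c) * norm a"
  proof (rule power2_le_imp_le)
    have "0 \<le> c * (norm (z t))\<^sup>2" using c by simp
    then have "(norm (z1 t))\<^sup>2 \<le> c * (norm a)\<^sup>2" using energy[OF t] by linarith
    \<comment> \<open>The natural bound is \<open>sqrt c * norm a\<close>; it is weakened so that a
      single majorant, a multiple of \<open>(1 + c) * norm a\<close>, covers every
      derivative.\<close>
    also have "\<dots> \<le> (1 + c)\<^sup>2 * (norm a)\<^sup>2"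
      using c by (intro mult_right_mono) (auto simp: power2_sum)
    finally show "(norm (z1 t))\<^sup>2 \<le> ((1 + c) * norm a)\<^sup>2" by (simp add: power_mult_distrib)
  qed (use c in simp)
  have z1_le: "norm (z1 t) \<le> (c * norm a) * t"
  proof (rule radial_derivative_bound[OF z z1 init(2) lam t])
    show "norm (z2 s + (2 * lam / s) *\<^sub>R z1 s) \<le> c * norm a" if s: "0 < s" "s \<le> t" for s
    proof -
      have "z2 s + (2 * lam / s) *\<^sub>R z1 s = - (c *\<^sub>R z s)"
        using eq[OF s(1)] by (simp add: eq_neg_iff_add_eq_0)
      then show ?thesis using z_le[OF s(1)] c by simp
    qed
  qed (use c in auto)
  have "z2 t = - (c *\<^sub>R z t) - (2 * lam / t) *\<^sub>R z1 t"
    using eq[OF t] by (simp add: algebra_simps eq_neg_iff_add_eq_0)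
  then have "norm (z2 t) \<le> norm (c *\<^sub>R z t) + norm ((2 * lam / t) *\<^sub>R z1 t)"
    by (metis norm_minus_cancel norm_triangle_ineq4)
  also have "\<dots> \<le> c * norm a + (2 * lam / t) * ((c * norm a) * t)"
  proof (rule add_mono)
    show "norm (c *\<^sub>R z t) \<le> c * norm a" using z_le[OF t] c by simp
    have "norm ((2 * lam / t) *\<^sub>R z1 t) = (2 * lam / t) * norm (z1 t)" using t lam by simp
    also have "\<dots> \<le> (2 * lam / t) * ((c * norm a) * t)"
      using z1_le by (rule mult_left_mono) (use lam t in simp)
    finally show "norm ((2 * lam / t) *\<^sub>R z1 t) \<le> (2 * lam / t) * ((c * norm a) * t)" .
  qed
  also have "\<dots> = (1 + 2 * lam) * (c * norm a)" using t by (simp add: field_simps)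
  finally show "norm (z2 t) \<le> (1 + 2 * lam) * (c * norm a)" .
qed

section \<open>Lifting pointwise derivatives through \<open>U\<close>\<close>

lemma vector_derivative_lipschitz:
  fixes p :: "real \<Rightarrow> 'a::real_normed_vector"
  assumes "convex S" and p: "\<And>s. s \<in> S \<Longrightarrow> (p has_vector_derivative p' s) (at s within S)"
    and le: "\<And>s. s \<in> S \<Longrightarrow> norm (p' s) \<le> K" and st: "s \<in> S" "t \<in> S"
  shows "norm (p s - p t) \<le> \<bar>s - t\<bar> * K"
proof -
  have "norm (p s - p t) \<le> K * norm (s - t)"
  proof (rule differentiable_bound[OF assms(1)])
    show "(p has_derivative (\<lambda>h. h *\<^sub>R p' x)) (at x within S)" if "x \<in> S" for x
      using p[OF that] by (simp add: has_vector_derivative_def)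
    show "onorm (\<lambda>h. h *\<^sub>R p' x) \<le> K" if "x \<in> S" for x
      using order_trans[OF norm_ge_zero le[OF that]] mult_left_mono[OF le[OF that]]
      by (intro onorm_bound) (auto simp: mult.commute[of K])
  qed (use st in auto)
  then show ?thesis by (simp add: mult.commute)
qed

lemma unitary_L2_diff:
  assumes "unitary_onto_L2 M U"
  shows "AE \<xi> in M. U (x - y) \<xi> = U x \<xi> - U y \<xi>"
proof -
  have "AE \<xi> in M. U (x + (-1) *\<^sub>R y) \<xi> = U x \<xi> + U ((-1) *\<^sub>R y) \<xi>"
    "AE \<xi> in M. U ((-1) *\<^sub>R y) \<xi> = (-1) *\<^sub>R U y \<xi>"
    using assms unfolding unitary_onto_L2_def by blast+
  then show ?thesis by eventually_elim simp
qed

lemma unitary_L2_inj: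
  assumes U: "unitary_onto_L2 M U" and "AE \<xi> in M. U x \<xi> = U y \<xi>"
  shows "x = y"
proof -
  have "(norm (x - y))\<^sup>2 = (\<integral>\<xi>. (norm (U (x - y) \<xi>))\<^sup>2 \<partial>M)"
    using U unfolding unitary_onto_L2_def by blast
  also have "AE \<xi> in M. (norm (U (x - y) \<xi>))\<^sup>2 = 0"
    using unitary_L2_diff[OF U, of x y] assms(2) by eventually_elim simp
  then have "(\<integral>\<xi>. (norm (U (x - y) \<xi>))\<^sup>2 \<partial>M) = 0" by (rule integral_eq_zero_AE)
  finally show ?thesis by simp
qed

lemma L2_measurable: "g \<in> L2 M \<Longrightarrow> g \<in> borel_measurable M"
  by (simp add: L2_def)

lemma L2_dominated:
  assumes g: "g \<in> borel_measurable M" and G: "integrable M (\<lambda>\<xi>. (G \<xi>)\<^sup>2)"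
    and le: "AE \<xi> in M. norm (g \<xi>) \<le> G \<xi>"
  shows "g \<in> L2 M"
proof -
  have "integrable M (\<lambda>\<xi>. (norm (g \<xi>))\<^sup>2)"
  proof (rule Bochner_Integration.integrable_bound[OF G])
    show "(\<lambda>\<xi>. (norm (g \<xi>))\<^sup>2) \<in> borel_measurable M" using g by measurable
    show "AE \<xi> in M. norm ((norm (g \<xi>))\<^sup>2) \<le> norm ((G \<xi>)\<^sup>2)"
      using le by eventually_elim (simp add: power_mono)
  qed
  with g show ?thesis by (simp add: L2_def)
qed

text \<open>The norm of a vector is the L2 norm of its image, so the normalized remainder can be
  treated by dominated convergence: it tends to 0 pointwise by \<open>deriv\<close> and is at most
  \<open>2 * G\<close>, one \<open>G\<close> from \<open>lip\<close> and one from
  \<open>le\<close>.\<close>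

lemma unitary_L2_has_vector_derivative:
  assumes U: "unitary_onto_L2 M U" and t: "t \<in> S"
    and x: "\<And>s. s \<in> S \<Longrightarrow> AE \<xi> in M. U (x s) \<xi> = p \<xi> s"
    and y: "AE \<xi> in M. U y \<xi> = p' \<xi>"
    and deriv: "AE \<xi> in M. (p \<xi> has_vector_derivative p' \<xi>) (at t within S)"
    and lip: "AE \<xi> in M. \<forall>s\<in>S. norm (p \<xi> s - p \<xi> t) \<le> \<bar>s - t\<bar> * G \<xi>"
    and le: "AE \<xi> in M. norm (p' \<xi>) \<le> G \<xi>"
    and G: "integrable M (\<lambda>\<xi>. (G \<xi>)\<^sup>2)"
  shows "(x has_vector_derivative y) (at t within S)"
  unfolding has_vector_derivative_def has_derivative_within
proof (intro conjI bounded_linear_scaleR_left)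
  have Uadd: "\<And>a b. AE \<xi> in M. U (a + b) \<xi> = U a \<xi> + U b \<xi>"
    and Uscale: "\<And>c a. AE \<xi> in M. U (c *\<^sub>R a) \<xi> = c *\<^sub>R U a \<xi>"
    and Unorm: "\<And>a. (norm a)\<^sup>2 = (\<integral>\<xi>. (norm (U a \<xi>))\<^sup>2 \<partial>M)"
    and UL2: "\<And>a. U a \<in> L2 M"
    using U unfolding unitary_onto_L2_def by blast+
  show "((\<lambda>s. (1 / norm (s - t)) *\<^sub>R (x s - (x t + (s - t) *\<^sub>R y))) \<longlongrightarrow> 0) (at t within S)"
    unfolding tendsto_at_iff_sequentially comp_def
  proof (intro allI impI)
    fix X :: "nat \<Rightarrow> real" assume X: "\<forall>i. X i \<in> S - {t}" and Xt: "X \<longlonglongrightarrow> t"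
    define d where "d i = (1 / norm (X i - t)) *\<^sub>R (x (X i) - (x t + (X i - t) *\<^sub>R y))" for i
    define q where "q i \<xi> = (1 / norm (X i - t)) *\<^sub>R (p \<xi> (X i) - (p \<xi> t + (X i - t) *\<^sub>R p' \<xi>))" for i \<xi>
    have Ud: "AE \<xi> in M. U (d i) \<xi> = q i \<xi>" for i
      using Uscale[of "1 / norm (X i - t)" "x (X i) - (x t + (X i - t) *\<^sub>R y)"]
        unitary_L2_diff[OF U, of "x (X i)" "x t + (X i - t) *\<^sub>R y"]
        Uadd[of "x t" "(X i - t) *\<^sub>R y"] Uscale[of "X i - t" y] x[of "X i"] x[OF t] y X
      unfolding d_def q_def by auto
    have "(\<lambda>i. \<integral>\<xi>. (norm (U (d i) \<xi>))\<^sup>2 \<partial>M) \<longlonglongrightarrow> (\<integral>\<xi>. 0 \<partial>M)"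
    proof (rule integral_dominated_convergence[where w="\<lambda>\<xi>. 4 * (G \<xi>)\<^sup>2"])
      show "(\<lambda>\<xi>. (norm (U (d i) \<xi>))\<^sup>2) \<in> borel_measurable M" for i
        using L2_measurable[OF UL2[of "d i"]] by measurable
      \<comment> \<open>Each \<open>d i\<close> has its own exceptional null set; along a sequence
        there are only countably many.\<close>
      have "AE \<xi> in M. \<forall>i. U (d i) \<xi> = q i \<xi>" using Ud by (simp add: AE_all_countable)
      then show "AE \<xi> in M. (\<lambda>i. (norm (U (d i) \<xi>))\<^sup>2) \<longlonglongrightarrow> 0"
        using deriv
      proof eventually_elim
        fix \<xi> assume q: "\<forall>i. U (d i) \<xi> = q i \<xi>"
          and p: "(p \<xi> has_vector_derivative p' \<xi>) (at t within S)"
        have "(\<lambda>i. q i \<xi>) \<longlonglongrightarrow> 0"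
          using p X Xt unfolding has_vector_derivative_def has_derivative_within
            tendsto_at_iff_sequentially comp_def q_def by blast
        then have "(\<lambda>i. (norm (q i \<xi>))\<^sup>2) \<longlonglongrightarrow> (norm (0::'c))\<^sup>2"
          by (intro tendsto_intros)
        then show "(\<lambda>i. (norm (U (d i) \<xi>))\<^sup>2) \<longlonglongrightarrow> 0" using q by simp
      qed
      show "AE \<xi> in M. norm ((norm (U (d i) \<xi>))\<^sup>2) \<le> 4 * (G \<xi>)\<^sup>2" for i
        using Ud[of i] lip le
      proof eventually_elim
        fix \<xi> assume q: "U (d i) \<xi> = q i \<xi>" and lip: "\<forall>s\<in>S. norm (p \<xi> s - p \<xi> t) \<le> \<bar>s - t\<bar> * G \<xi>"
          and le: "norm (p' \<xi>) \<le> G \<xi>"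
        have pos: "0 < \<bar>X i - t\<bar>" using X by auto
        have "norm (p \<xi> (X i) - (p \<xi> t + (X i - t) *\<^sub>R p' \<xi>))
            \<le> norm (p \<xi> (X i) - p \<xi> t) + norm ((X i - t) *\<^sub>R p' \<xi>)"
          using norm_triangle_ineq4[of "p \<xi> (X i) - p \<xi> t" "(X i - t) *\<^sub>R p' \<xi>"]
          by (simp add: diff_diff_eq)
        also have "\<dots> \<le> \<bar>X i - t\<bar> * G \<xi> + \<bar>X i - t\<bar> * G \<xi>"
          using lip X le by (intro add_mono) (auto intro: mult_left_mono)
        finally have "norm (p \<xi> (X i) - (p \<xi> t + (X i - t) *\<^sub>R p' \<xi>)) / \<bar>X i - t\<bar> \<le> 2 * G \<xi>"
          unfolding pos_divide_le_eq[OF pos] by (simp add: algebra_simps)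
        then have "norm (q i \<xi>) \<le> 2 * G \<xi>" by (simp add: q_def)
        then have "(norm (q i \<xi>))\<^sup>2 \<le> (2 * G \<xi>)\<^sup>2" by (rule power_mono) simp
        then show "norm ((norm (U (d i) \<xi>))\<^sup>2) \<le> 4 * (G \<xi>)\<^sup>2"
          by (simp add: q power_mult_distrib)
      qed
    qed (use G in auto)
    then have "(\<lambda>i. (norm (d i))\<^sup>2) \<longlonglongrightarrow> 0" by (simp add: Unorm)
    then have "(\<lambda>i. sqrt ((norm (d i))\<^sup>2)) \<longlonglongrightarrow> sqrt 0" by (intro tendsto_intros)
    then show "(\<lambda>i. (1 / norm (X i - t)) *\<^sub>R (x (X i) - (x t + (X i - t) *\<^sub>R y))) \<longlonglongrightarrow> 0"
      unfolding d_def[symmetric] by (simp add: tendsto_norm_zero_iff)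
  qed
qed

lemma spectral_solves_EPD_imp_solves_EPD:
  assumes rep: "spectral_representation D A M m U" and sol: "spectral_solves_EPD lam M m U f u"
    and lam: "0 \<le> lam" and f: "f \<in> D"
  shows "solves_EPD lam D A f u"
proof -
  have m: "m \<in> borel_measurable M" and mpos: "AE \<xi> in M. 0 < m \<xi>" and U: "unitary_onto_L2 M U"
    and dom: "\<And>x. x \<in> D \<longleftrightarrow> (\<lambda>\<xi>. m \<xi> *\<^sub>R U x \<xi>) \<in> L2 M"
    and UA: "\<And>x. x \<in> D \<Longrightarrow> AE \<xi> in M. U (A x) \<xi> = m \<xi> *\<^sub>R U x \<xi>"
    using rep unfolding spectral_representation_def by blast+
  have UL2: "U x \<in> L2 M" and Uscale: "AE \<xi> in M. U (c *\<^sub>R x) \<xi> = c *\<^sub>R U x \<xi>" for c x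
    using U unfolding unitary_onto_L2_def by blast+
  have Umeas: "U x \<in> borel_measurable M" for x by (rule L2_measurable[OF UL2])
  have Usurj: "\<exists>x. AE \<xi> in M. U x \<xi> = g \<xi>" if "g \<in> L2 M" for g
    using U that unfolding unitary_onto_L2_def by blast
  obtain v where uv: "\<And>t. 0 \<le> t \<Longrightarrow> AE \<xi> in M. U (u t) \<xi> = v \<xi> t"
    and vsol: "AE \<xi> in M. solves_EPD lam UNIV (\<lambda>z. m \<xi> *\<^sub>R z) (U f \<xi>) (v \<xi>)"
    using sol unfolding spectral_solves_EPD_def by blast
  obtain v1 v2 where v12: "AE \<xi> in M. (\<forall>t\<ge>0. (v \<xi> has_vector_derivative v1 \<xi> t) (at t within {0..})) \<and>
     (\<forall>t>0. (v1 \<xi> has_vector_derivative v2 \<xi> t) (at t)) \<and>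
     (\<forall>t>0. v2 \<xi> t + (2 * lam / t) *\<^sub>R v1 \<xi> t + m \<xi> *\<^sub>R v \<xi> t = 0) \<and>
     v \<xi> 0 = U f \<xi> \<and> v1 \<xi> 0 = 0"
  proof -
    \<comment> \<open>The scalar problem may fail on a null set; as a premise under the existential
      it lets the derivatives be chosen for every \<open>\<xi>\<close>.\<close>
    have "\<forall>\<xi>. \<exists>w1 w2. solves_EPD lam UNIV (\<lambda>z. m \<xi> *\<^sub>R z) (U f \<xi>) (v \<xi>) \<longrightarrow>
      (\<forall>t\<ge>0. (v \<xi> has_vector_derivative w1 t) (at t within {0..})) \<and>
      (\<forall>t>0. (w1 has_vector_derivative w2 t) (at t)) \<and>
      (\<forall>t>0. w2 t + (2 * lam / t) *\<^sub>R w1 t + m \<xi> *\<^sub>R v \<xi> t = 0) \<and>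
      v \<xi> 0 = U f \<xi> \<and> w1 0 = 0"
      unfolding solves_EPD_def by auto
    then obtain w1 w2 where w: "\<And>\<xi>. solves_EPD lam UNIV (\<lambda>z. m \<xi> *\<^sub>R z) (U f \<xi>) (v \<xi>) \<longrightarrow>
      (\<forall>t\<ge>0. (v \<xi> has_vector_derivative w1 \<xi> t) (at t within {0..})) \<and>
      (\<forall>t>0. (w1 \<xi> has_vector_derivative w2 \<xi> t) (at t)) \<and>
      (\<forall>t>0. w2 \<xi> t + (2 * lam / t) *\<^sub>R w1 \<xi> t + m \<xi> *\<^sub>R v \<xi> t = 0) \<and>
      v \<xi> 0 = U f \<xi> \<and> w1 \<xi> 0 = 0"
      by metis
    show thesis by (rule that[of w1 w2]) (use vsol w in \<open>auto elim!: eventually_mono\<close>)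
  qed
  \<comment> \<open>One majorant for \<open>m v\<close>, \<open>v1\<close> and \<open>v2\<close> at
    all times; the factor \<open>1 + 2 * lam\<close> comes from \<open>v2\<close>.\<close>
  define G where "G \<xi> = (1 + 2 * lam) * ((1 + m \<xi>) * norm (U f \<xi>))" for \<xi>
  have good: "AE \<xi> in M. 0 < m \<xi> \<and>
    (\<forall>t\<ge>0. (v \<xi> has_vector_derivative v1 \<xi> t) (at t within {0..})) \<and>
    (\<forall>t>0. (v1 \<xi> has_vector_derivative v2 \<xi> t) (at t)) \<and>
    (\<forall>t>0. v2 \<xi> t + (2 * lam / t) *\<^sub>R v1 \<xi> t + m \<xi> *\<^sub>R v \<xi> t = 0) \<and>
    v \<xi> 0 = U f \<xi> \<and> v1 \<xi> 0 = 0 \<and>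
    (\<forall>t\<ge>0. norm (m \<xi> *\<^sub>R v \<xi> t) \<le> G \<xi> \<and> norm (v1 \<xi> t) \<le> G \<xi>) \<and> (\<forall>t>0. norm (v2 \<xi> t) \<le> G \<xi>)"
    using v12 mpos
  proof eventually_elim
    case (elim \<xi>)
    let ?n = "norm (U f \<xi>)"
    have G: "m \<xi> * ?n \<le> G \<xi>" "(1 + m \<xi>) * ?n \<le> G \<xi>" "(1 + 2 * lam) * (m \<xi> * ?n) \<le> G \<xi>" "0 \<le> G \<xi>"
    proof -
      have 1: "m \<xi> * ?n \<le> (1 + m \<xi>) * ?n" by (intro mult_right_mono) auto
      have 2: "0 \<le> (1 + m \<xi>) * ?n" using elim by simp
      show 3: "(1 + m \<xi>) * ?n \<le> G \<xi>"
        using lam mult_right_mono[OF _ 2, of 1 "1 + 2 * lam"] by (simp add: G_def)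
      show "m \<xi> * ?n \<le> G \<xi>" "0 \<le> G \<xi>" using 1 2 3 by linarith+
      show "(1 + 2 * lam) * (m \<xi> * ?n) \<le> G \<xi>" unfolding G_def using lam 1 by (intro mult_left_mono) auto
    qed
    note b = scalar_EPD_bounds[of "v \<xi>" "v1 \<xi>" "v2 \<xi>" lam "m \<xi>" "U f \<xi>"]
    have b1: "norm (v \<xi> t) \<le> ?n" "norm (v1 \<xi> t) \<le> G \<xi>" "norm (v2 \<xi> t) \<le> G \<xi>" if "0 < t" for t
      using b[OF _ _ _ _ _ lam _ that] elim G by (blast intro: order_trans)+
    have "norm (m \<xi> *\<^sub>R v \<xi> t) \<le> G \<xi>" if "0 \<le> t" for t
    proof -
      have "norm (v \<xi> t) \<le> ?n" using b1(1)[of t] elim that by (cases "t = 0") auto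
      then have "m \<xi> * norm (v \<xi> t) \<le> m \<xi> * ?n" using elim by (intro mult_left_mono) auto
      also have "\<dots> \<le> G \<xi>" by (rule G)
      finally show ?thesis using elim by simp
    qed
    moreover have "norm (v1 \<xi> t) \<le> G \<xi>" if "0 \<le> t" for t
      using b1(2)[of t] elim that G by (cases "t = 0") auto
    ultimately show ?case using elim b1(3) by blast
  qed
  have G2: "integrable M (\<lambda>\<xi>. (G \<xi>)\<^sup>2)"
  proof (rule Bochner_Integration.integrable_bound)
    let ?H = "\<lambda>\<xi>. (1 + 2 * lam)\<^sup>2 * (2 * (norm (U f \<xi>))\<^sup>2 + 2 * (norm (m \<xi> *\<^sub>R U f \<xi>))\<^sup>2)"
    show "integrable M ?H"
      using UL2[of f] dom[of f] f by (auto simp: L2_def)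
    show "(\<lambda>\<xi>. (G \<xi>)\<^sup>2) \<in> borel_measurable M"
      using m Umeas[of f] unfolding G_def by measurable
    have "(G \<xi>)\<^sup>2 \<le> ?H \<xi>" for \<xi>
    proof -
      \<comment> \<open>The inequality (a + b)^2 \<le> 2 a^2 + 2 b^2 reduces square integrability of
        \<open>G\<close> to that of \<open>U f\<close> and \<open>m U f\<close>, the latter being
        the meaning of \<open>f \<in> D\<close>.\<close>
      have "((1 + m \<xi>) * norm (U f \<xi>))\<^sup>2 \<le> 2 * (norm (U f \<xi>))\<^sup>2 + 2 * (norm (m \<xi> *\<^sub>R U f \<xi>))\<^sup>2"
        using sum_squares_bound[of "norm (U f \<xi>)" "m \<xi> * norm (U f \<xi>)"]
        by (simp add: distrib_right power2_sum power_mult_distrib)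
      then show ?thesis unfolding G_def power_mult_distrib[of "1 + 2 * lam"] by (intro mult_left_mono) auto
    qed
    then show "AE \<xi> in M. norm ((G \<xi>)\<^sup>2) \<le> norm (?H \<xi>)"
      unfolding real_norm_def abs_power2 by (intro AE_I2 order_trans[OF _ abs_ge_self])
  qed
  have uD: "u t \<in> D" if t: "0 \<le> t" for t
  proof -
    have "(\<lambda>\<xi>. m \<xi> *\<^sub>R U (u t) \<xi>) \<in> L2 M"
    proof (rule L2_dominated[OF _ G2])
      show "(\<lambda>\<xi>. m \<xi> *\<^sub>R U (u t) \<xi>) \<in> borel_measurable M" using m Umeas[of "u t"] by measurable
      show "AE \<xi> in M. norm (m \<xi> *\<^sub>R U (u t) \<xi>) \<le> G \<xi>"
        using good uv[OF t] by eventually_elim (use t in auto)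
    qed
    then show ?thesis by (simp add: dom)
  qed
  \<comment> \<open>Measurability of \<open>v1 \<xi> t\<close> in \<open>\<xi>\<close> has to be
    produced. The difference quotients of \<open>u\<close> are vectors whose images are measurable
    and converge almost everywhere to \<open>v1 \<xi> t\<close>; the limit is dominated by
    \<open>G\<close>, and surjectivity of \<open>U\<close> yields the velocity.\<close>
  have "\<exists>x. 0 \<le> t \<longrightarrow> (AE \<xi> in M. U x \<xi> = v1 \<xi> t)" for t
  proof (cases "0 \<le> t")
    case t: True
    define h where "h n = inverse (real (Suc n))" for n
    have h: "0 < h n" for n by (simp add: h_def)
    have h0: "h \<longlonglongrightarrow> 0" unfolding h_def by (rule LIMSEQ_inverse_real_of_nat)
    define q where "q n = (1 / h n) *\<^sub>R (u (t + h n) - u t)" for n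
    have Uq: "AE \<xi> in M. \<forall>n. U (q n) \<xi> = (1 / h n) *\<^sub>R (v \<xi> (t + h n) - v \<xi> t)"
      unfolding AE_all_countable
    proof
      fix n
      show "AE \<xi> in M. U (q n) \<xi> = (1 / h n) *\<^sub>R (v \<xi> (t + h n) - v \<xi> t)"
        using Uscale[of "1 / h n" "u (t + h n) - u t"] unitary_L2_diff[OF U, of "u (t + h n)" "u t"]
          uv[OF t] uv[of "t + h n"] t h[of n] unfolding q_def by auto
    qed
    have lim: "AE \<xi> in M. (\<lambda>n. U (q n) \<xi>) \<longlonglongrightarrow> v1 \<xi> t"
      using Uq good
    proof eventually_elim
      case (elim \<xi>)
      then have "(v \<xi> has_vector_derivative v1 \<xi> t) (at t within {0..})" using t by blast
      then have "((\<lambda>s. (1 / norm (s - t)) *\<^sub>R (v \<xi> s - (v \<xi> t + (s - t) *\<^sub>R v1 \<xi> t))) \<longlongrightarrow> 0)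
          (at t within {0..})"
        unfolding has_vector_derivative_def has_derivative_within by blast
      moreover have "t + h n \<in> {0..} - {t}" for n using h[of n] t by auto
      moreover have "(\<lambda>n. t + h n) \<longlonglongrightarrow> t" using tendsto_add[OF tendsto_const h0, of t] by simp
      ultimately have "(\<lambda>n. (1 / norm (t + h n - t)) *\<^sub>R
          (v \<xi> (t + h n) - (v \<xi> t + (t + h n - t) *\<^sub>R v1 \<xi> t))) \<longlonglongrightarrow> 0"
        unfolding tendsto_at_iff_sequentially comp_def by (elim allE[of _ "\<lambda>n. t + h n"]) simp
      moreover have "(1 / norm (t + h n - t)) *\<^sub>R (v \<xi> (t + h n) - (v \<xi> t + (t + h n - t) *\<^sub>R v1 \<xi> t))
          = U (q n) \<xi> - v1 \<xi> t" for n
        using elim(1) h[of n] by (simp add: algebra_simps)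
      ultimately show ?case by (simp add: LIM_zero_iff)
    qed
    define g where "g \<xi> = lim (\<lambda>n. U (q n) \<xi>)" for \<xi>
    have gv: "AE \<xi> in M. g \<xi> = v1 \<xi> t"
      using lim by eventually_elim (simp add: g_def limI)
    have "g \<in> L2 M"
    proof (rule L2_dominated[OF _ G2])
      show "g \<in> borel_measurable M"
        unfolding g_def by (rule borel_measurable_lim_metric) (rule Umeas)
      show "AE \<xi> in M. norm (g \<xi>) \<le> G \<xi>" using gv good by eventually_elim (use t in auto)
    qed
    then obtain x where "AE \<xi> in M. U x \<xi> = g \<xi>" using Usurj by blast
    then have "AE \<xi> in M. U x \<xi> = v1 \<xi> t" using gv by eventually_elim simp
    then show ?thesis by blast
  qed simp
  then obtain u1 where u1: "\<And>t. 0 \<le> t \<Longrightarrow> AE \<xi> in M. U (u1 t) \<xi> = v1 \<xi> t" by metis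
  \<comment> \<open>Solved from the equation, which then holds by definition; what remains is that
    \<open>U (u2 t)\<close> represents \<open>v2\<close>.\<close>
  define u2 where "u2 t = (- (2 * lam / t)) *\<^sub>R u1 t - A (u t)" for t
  have u2: "AE \<xi> in M. U (u2 t) \<xi> = v2 \<xi> t" if t: "0 < t" for t
    using unitary_L2_diff[OF U, of "(- (2 * lam / t)) *\<^sub>R u1 t" "A (u t)"]
      Uscale[of "- (2 * lam / t)" "u1 t"] u1[OF less_imp_le[OF t]] UA[OF uD[OF less_imp_le[OF t]]]
      uv[OF less_imp_le[OF t]] good
  proof eventually_elim
    case (elim \<xi>)
    then have "v2 \<xi> t + (2 * lam / t) *\<^sub>R v1 \<xi> t + m \<xi> *\<^sub>R v \<xi> t = 0" using t by blast
    then have "v2 \<xi> t = (- (2 * lam / t)) *\<^sub>R v1 \<xi> t - m \<xi> *\<^sub>R v \<xi> t"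
      by (simp add: algebra_simps eq_neg_iff_add_eq_0)
    then show ?case using elim(1-5) by (simp only: u2_def)
  qed
  show ?thesis
    unfolding solves_EPD_def
  proof (rule exI[of _ u1], rule exI[of _ u2], intro conjI allI impI)
    show "(u has_vector_derivative u1 t) (at t within {0..})" if t: "0 \<le> t" for t
    proof (rule unitary_L2_has_vector_derivative[OF U _ _ u1[OF t] _ _ _ G2])
      show "AE \<xi> in M. \<forall>s\<in>{0..}. norm (v \<xi> s - v \<xi> t) \<le> \<bar>s - t\<bar> * G \<xi>"
        using good
      proof eventually_elim
        case (elim \<xi>)
        then show ?case
          using t by (intro ballI vector_derivative_lipschitz[where S="{0..}" and p'="v1 \<xi>"]) auto
      qed
      show "AE \<xi> in M. (v \<xi> has_vector_derivative v1 \<xi> t) (at t within {0..})"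
        using good t by (auto elim: eventually_mono)
      show "AE \<xi> in M. norm (v1 \<xi> t) \<le> G \<xi>" using good t by (auto elim: eventually_mono)
    qed (use t uv in auto)
    show "(u1 has_vector_derivative u2 t) (at t)" if t: "0 < t" for t
    proof -
      have at: "at s within {0<..} = at s" if "0 < s" for s :: real
        using that by (intro at_within_open) auto
      \<comment> \<open>The Lipschitz bound for \<open>v1\<close> lives on the open half-line,
        because \<open>v2\<close> is its derivative only at positive times.\<close>
      have "(u1 has_vector_derivative u2 t) (at t within {0<..})"
      proof (rule unitary_L2_has_vector_derivative[OF U _ _ u2[OF t] _ _ _ G2])
        show "AE \<xi> in M. \<forall>s\<in>{0<..}. norm (v1 \<xi> s - v1 \<xi> t) \<le> \<bar>s - t\<bar> * G \<xi>"
          using good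
        proof eventually_elim
          case (elim \<xi>)
          then show ?case
            using t by (intro ballI vector_derivative_lipschitz[where S="{0<..}" and p'="v2 \<xi>"])
              (auto simp: at)
        qed
        show "AE \<xi> in M. (v1 \<xi> has_vector_derivative v2 \<xi> t) (at t within {0<..})"
          using good t by (auto elim: eventually_mono simp: at)
        show "AE \<xi> in M. norm (v2 \<xi> t) \<le> G \<xi>" using good t by (auto elim: eventually_mono)
      qed (use t u1 in auto)
      then show ?thesis by (simp add: at t)
    qed
    show "u t \<in> D" if "0 < t" for t using uD that by simp
    show "u2 t + (2 * lam / t) *\<^sub>R u1 t + A (u t) = 0" for t by (simp add: u2_def)
    show "u 0 = f"
      by (rule unitary_L2_inj[OF U]) (use uv[of 0] good in \<open>auto elim: eventually_elim2\<close>)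
    show "u1 0 = 0"
    proof (rule unitary_L2_inj[OF U])
      show "AE \<xi> in M. U (u1 0) \<xi> = U 0 \<xi>"
        using u1[of 0] good Uscale[of 0 0] by auto
    qed
  qed
qed

text \<open>Hence the transfer from the spectral representation, proved for all
  \<open>lam \<ge> 0\<close>, serves both equations.\<close>

lemma solves_wave_iff_EPD: "solves_wave D A f u \<longleftrightarrow> solves_EPD 0 D A f u"
  by (simp add: solves_wave_def solves_EPD_def)

lemma spectral_solves_wave_iff_EPD: "spectral_solves_wave M m U f u \<longleftrightarrow> spectral_solves_EPD 0 M m U f u"
  by (simp add: spectral_solves_wave_def spectral_solves_EPD_def solves_wave_iff_EPD)

theorem mainTheorem9:
  fixes D :: "'h::{real_inner, complete_space} set"
    and A :: "'h \<Rightarrow> 'h"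
    and f :: 'h
    and lam :: real
    and M :: "'o measure"
    and m :: "'o \<Rightarrow> real"
    and U :: "'h \<Rightarrow> 'o \<Rightarrow> 'k::{real_normed_field, euclidean_space}"
    and u ubar :: "real \<Rightarrow> 'h"
  assumes "lam > 0"
    and "selfadjoint D A" and "positive_operator D A" and "inj_on A D"
    and "f \<in> D"
    and "solves_EPD lam D A f u \<or>
         spectral_representation D A M m U \<and> spectral_solves_EPD lam M m U f u"
    and "solves_wave D A f ubar \<or>
         spectral_representation D A M m U \<and> spectral_solves_wave M m U f ubar"
  shows "\<forall>t>0. EK_integrable lam 1 (\<lambda>y. (1 / sqrt y) *\<^sub>R ubar (t * sqrt y)) 1 \<and>
           u t = (Gamma (lam + 1 / 2) / sqrt pi) *\<^sub>R
                 EK_integral lam 1 (\<lambda>y. (1 / sqrt y) *\<^sub>R ubar (t * sqrt y)) 1"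
proof (intro allI impI)
  fix t :: real assume t: "0 < t"
  let ?g = "\<lambda>y. (1 / sqrt y) *\<^sub>R ubar (t * sqrt y)"
  have u: "solves_EPD lam D A f u"
    using assms(1,5,6) spectral_solves_EPD_imp_solves_EPD[of D A M m U lam f u] by auto
  have ubar: "solves_wave D A f ubar"
    using assms(5,7) spectral_solves_EPD_imp_solves_EPD[of D A M m U 0 f ubar]
    unfolding solves_wave_iff_EPD spectral_solves_wave_iff_EPD by auto
  then obtain w1 where "\<And>s. 0 \<le> s \<Longrightarrow> (ubar has_vector_derivative w1 s) (at s within {0..})"
    unfolding solves_wave_def by blast
  then have cont: "continuous_on {0..} ubar" by (rule continuous_on_nonneg_if_differentiable)
  have "has_bochner Ioo01 (\<lambda>y. EK_kernel lam y *\<^sub>R ubar (t * sqrt y)) (Beta (1/2) lam *\<^sub>R u t)"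
    by (intro weak_integral_imp_has_bochner integrable.intros[OF EK_kernel_has_integral]
        EK_kernel_continuous continuous_on_dilation cont t assms(1)
        EPD_solution_eq_EK_wave[OF assms(1-3) u ubar t])
  moreover have "EK_integrand lam 1 ?g 1 y = EK_kernel lam y *\<^sub>R ubar (t * sqrt y)"
    if "y \<in> space Ioo01" for y
    using that by (simp add: EK_integrand_def EK_kernel_def)
  ultimately have hb: "has_bochner Ioo01 (EK_integrand lam 1 ?g 1) (Beta (1/2) lam *\<^sub>R u t)"
    by (subst has_bochner_cong) auto
  have "EK_integral lam 1 ?g 1 = (1 / Gamma lam) *\<^sub>R Beta (1/2) lam *\<^sub>R u t"
    unfolding EK_integral_def bochner_integral_eq[OF hb] ..
  \<comment> \<open>Beta(1/2, lam) is \<open>sqrt pi * Gamma lam / Gamma (lam + 1/2)\<close>,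
    because \<open>Gamma (1/2) = sqrt pi\<close>.\<close>
  moreover have "(Gamma (lam + 1 / 2) / sqrt pi) * ((1 / Gamma lam) * Beta (1/2) lam) = 1"
  proof -
    have "Gamma lam \<noteq> 0" "Gamma (lam + 1/2) \<noteq> 0"
      by (rule less_imp_neq[symmetric], rule Gamma_real_pos, use assms(1) in simp)+
    then show ?thesis by (simp add: Beta_def Gamma_one_half_real add.commute)
  qed
  ultimately have "u t = (Gamma (lam + 1 / 2) / sqrt pi) *\<^sub>R EK_integral lam 1 ?g 1"
    by (simp del: times_divide_eq_left times_divide_eq_right)
  then show "EK_integrable lam 1 ?g 1 \<and>
      u t = (Gamma (lam + 1 / 2) / sqrt pi) *\<^sub>R EK_integral lam 1 ?g 1"
    using hb unfolding EK_integrable_def bochner_integrable_def by blast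
qed

end
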